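(* Let $n\ge 1$ and let $\lambda=(\lambda_1,\ldots,\lambda_n)\in\mathbb{C}^n$ with $|\lambda_1|=\ldots=|\lambda_n|=1$ be nonresonant, i.e. for $k_1,\ldots,k_n\in\mathbb{Z}$ the equation $\lambda_1^{k_1}\cdots\lambda_n^{k_n}=1$ holds only if $k_1=\ldots=k_n=0$. Then for any real $f_0<0$ and any real $a_1,\ldots,a_n>0$ there exist formal power series $$f(x)=\sum_{k=0}^\infty f^{(2k)}(x),\qquad f^{(2k)}(x)=\sum_{s\in\mathbb{Z}_+^n,\ \|s\|=k} f_{2s}\,x^{2s},\qquad \chi=(\chi_1,\ldots,\chi_n)=\sum_{k=0}^\infty\chi^{(2k+1)}(z,\bar z),$$ where $\chi^{(2k+1)}$ is homogeneous of degree $2k+1$ in $(z,\bar z)=(z_1,\ldots,z_n,\bar z_1,\ldots,\bar z_n)$, with $f^{(0)}=f_0$ and $$f^{(2)}(x)=\sum_{j=1}^n \mathcal{F}_{e_j}x_j^2,\qquad \mathcal{F}_{e_j}=\frac{2-\lambda_j-\lambda_j^{-1}}{-8f_0},\qquad \chi_j^{(1)}=a_j(z_j+\bar z_j)\quad (j=1,\ldots,n),$$ such that $(f,\chi)$ satisfies, as an identity of formal power series in $(z,\bar z)$ (respectively of 1-forms with such coefficients), the system $$\Big[\sum_{j=1}^n\Big(\frac{\tau_-\chi_j+(\tau_- f\circ\chi)\,(\partial_{x_j} f)\circ\chi}{L(\chi\circ\rho^{-1},\chi)}+\frac{\tau_+\chi_j+(\tau_+ f\circ\chi)\,(\partial_{x_j}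 f)\circ\chi}{L(\chi,\chi\circ\rho)}\Big)\,d\chi_j\Big]=0,$$ $$\Big\langle\Big(\sum_{j=1}^n(\tau_-\chi_j)^2+(\tau_- f\circ\chi)^2\Big)^{1/2}\Big\rangle=L(0,0),$$ and the following conditions: (1) $f$ has real coefficients and is even in each variable $x_j$; (2) $\chi$ is real: the coefficients of $\chi(z,\bar z)=\sum_{s',s''\in\mathbb{Z}_+^n}\chi_{s's''}z^{s'}\bar z^{s''}$ satisfy $\chi_{s's''}=\overline{\chi_{s''s'}}$ for all $s',s''$; (3) each $\chi_j$ is odd: $\chi_j(-z,-\bar z)=-\chi_j(z,\bar z)$; (4) $\det\dfrac{\partial(\chi_-,\chi)}{\partial(z,\bar z)}\Big|_{z=\bar z=0}\neq 0$, where $\chi_-=\chi\circ\rho^{-1}$.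
   Context: Notation. $\mathbb{Z}_+=\{0,1,2,\ldots\}$; for $s\in\mathbb{Z}_+^n$, $\|s\|=s_1+\ldots+s_n$ and $x^{2s}=x_1^{2s_1}\cdots x_n^{2s_n}$; $e_j\in\mathbb{Z}_+^n$ is the $j$-th unit vector. The variables $z_j,\bar z_j$ are the coordinates on $\mathbb{C}^n\cong\mathbb{R}^{2n}$ (in formal series they are treated as $2n$ independent variables). The map $\rho$ is $\rho(z)=(\lambda_1z_1,\ldots,\lambda_nz_n)$, acting on functions or formal series by $g\circ\rho^{\pm1}$, i.e. $z_j\mapsto\lambda_j^{\pm1}z_j$, $\bar z_j\mapsto\lambda_j^{\mp1}\bar z_j$. The discrete Lagrangian of the billiard between the graphs of $f$ and $-f$ is $L(x,y)=\big(|x-y|^2+(f(x)+f(y))^2\big)^{1/2}$, $x,y\in\mathbb{R}^n$, with $|\cdot|$ the Euclidean norm (so $L(0,0)=2|f(0)|=2|f_0|$). In the formal setting $L(\chi,\chi\circ\rho)$ etc. are the formal power series obtained by substitution in this formula; since the constant term of $L^2$ is $4f_0^2\ne0$, the square root (with constant term $2|f_0|$) and its inverse are well-defined formal power series. Operators: $\tau_\pm\chi=\chi-\chi\circ\rho^{\pm1}$ and $\tau_\pm f\circ\chi=f\circ\chi+f\circ\chi\circ\rho^{\pm1}$ (different signs on $\chi$ and on $f\circ\chi$). Averaging: the torus $\mathbb{T}^n=\mathbb{R}^n/(2\pi\mathbb{Z}^n)$ acts on $\mathbb{C}^n$ by $\rho_\alpha z=(e^{i\alpha_1}z_1,\ldots,e^{i\alpha_n}z_n)$.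 For a function or differential form $g$, $\langle g\rangle=\frac1{(2\pi)^n}\int_{\mathbb{T}^n}\rho_\alpha^*g\,d\alpha$ and $[g]=g-\langle g\rangle$. For a series $g=\sum g_{k'k''}z^{k'}\bar z^{k''}$ this means $\langle g\rangle=\sum_k g_{kk}z^k\bar z^k$; for formal 1-forms averaging is applied termwise, so it keeps exactly the terms $z^u\bar z^v\,dz_j$ with $u+e_j=v$ and $z^u\bar z^v\,d\bar z_j$ with $u=v+e_j$. For a formal series $\chi_j$, $d\chi_j=\sum_l(\partial_{z_l}\chi_j\,dz_l+\partial_{\bar z_l}\chi_j\,d\bar z_l)$. *)

theory Defs
  imports "HOL-Analysis.Analysis"
begin

section \<open>Multi-indices\<close>

definition mdeg :: "nat ^ 'v \<Rightarrow> nat" where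
  "mdeg s = (\<Sum>v\<in>UNIV. s $ v)"

lemma mdeg_0 [simp]: "mdeg 0 = 0"
  by (simp add: mdeg_def)

lemma mdeg_add [simp]: "mdeg (s + t) = mdeg s + mdeg t"
  by (simp add: mdeg_def sum.distrib)

lemma mdeg_eq_0_iff [simp]: "mdeg s = 0 \<longleftrightarrow> s = 0"
  by (simp add: mdeg_def vec_eq_iff)

lemma finite_mdeg_le [simp]: "finite {s :: nat ^ 'v. mdeg s \<le> d}"
proof -
  have "{s :: nat ^ 'v. mdeg s \<le> d} \<subseteq> vec_lambda ` (UNIV \<rightarrow>\<^sub>E {..d})"
  proof
    fix s :: "nat ^ 'v" assume "s \<in> {s. mdeg s \<le> d}"
    then have "s $ v \<le> d" for v
      using member_le_sum[of v UNIV "\<lambda>v. s $ v"] by (simp add: mdeg_def)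
    then have "(\<lambda>v. s $ v) \<in> UNIV \<rightarrow>\<^sub>E {..d}" by auto
    then have "vec_lambda (\<lambda>v. s $ v) \<in> vec_lambda ` (UNIV \<rightarrow>\<^sub>E {..d})" by (rule imageI)
    then show "s \<in> vec_lambda ` (UNIV \<rightarrow>\<^sub>E {..d})" by simp
  qed
  moreover have "finite (vec_lambda ` ((UNIV :: 'v set) \<rightarrow>\<^sub>E {..d}))"
    by (intro finite_imageI finite_PiE) auto
  ultimately show ?thesis by (rule finite_subset)
qed

lemma finite_splits [simp]: "finite {(a, b). a + b = (m :: nat ^ 'v)}"
  by (rule finite_subset[of _ "{a. mdeg a \<le> mdeg m} \<times> {b. mdeg b \<le> mdeg m}"]) auto


section \<open>Formal power series in finitely many variables\<close>

text \<open>The variables are indexed by the finite type \<open>'v\<close>; a series is the family of its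
  coefficients.\<close>

typedef (overloaded) ('a, 'v :: finite) mfps = "UNIV :: (nat ^ 'v \<Rightarrow> 'a) set"
  morphisms mfps_nth Abs_mfps ..

lemma mfps_nth_Abs [simp]: "mfps_nth (Abs_mfps f) = f"
  by (simp add: Abs_mfps_inverse)

lemma mfps_eqI: "(\<And>m. mfps_nth f m = mfps_nth g m) \<Longrightarrow> f = g"
  by (simp add: mfps_nth_inject[symmetric] fun_eq_iff)

instantiation mfps :: (comm_ring_1, finite) comm_ring_1
begin

definition zero_mfps :: "('a, 'b) mfps" where "0 = Abs_mfps (\<lambda>_. 0)"
definition one_mfps :: "('a, 'b) mfps" where "1 = Abs_mfps (\<lambda>m. if m = 0 then 1 else 0)"
definition plus_mfps :: "('a, 'b) mfps \<Rightarrow> ('a, 'b) mfps \<Rightarrow> ('a, 'b) mfps" where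
  "f + g = Abs_mfps (\<lambda>m. mfps_nth f m + mfps_nth g m)"
definition minus_mfps :: "('a, 'b) mfps \<Rightarrow> ('a, 'b) mfps \<Rightarrow> ('a, 'b) mfps" where
  "f - g = Abs_mfps (\<lambda>m. mfps_nth f m - mfps_nth g m)"
definition uminus_mfps :: "('a, 'b) mfps \<Rightarrow> ('a, 'b) mfps" where
  "- f = Abs_mfps (\<lambda>m. - mfps_nth f m)"
definition times_mfps :: "('a, 'b) mfps \<Rightarrow> ('a, 'b) mfps \<Rightarrow> ('a, 'b) mfps" where
  "f * g = Abs_mfps (\<lambda>m. \<Sum>(a, b) | a + b = m. mfps_nth f a * mfps_nth g b)"

instance
proof
  fix f g h :: "('a, 'b) mfps"
  show "f * g * h = f * (g * h)"
  proof (rule mfps_eqI)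
    fix m :: "nat ^ 'b"
    let ?t = "\<lambda>a b c. mfps_nth f a * mfps_nth g b * mfps_nth h c"
    have "mfps_nth (f * g * h) m
        = (\<Sum>p | fst p + snd p = m. \<Sum>q | fst q + snd q = fst p. ?t (fst q) (snd q) (snd p))"
      by (simp add: times_mfps_def case_prod_unfold sum_distrib_right)
    also have "\<dots> = (\<Sum>(p, q) \<in> (SIGMA p : {p. fst p + snd p = m}. {q. fst q + snd q = fst p}).
        ?t (fst q) (snd q) (snd p))"
      using finite_splits by (subst sum.Sigma) (auto simp: case_prod_unfold)
    also have "\<dots> = (\<Sum>(p, q) \<in> (SIGMA p : {p. fst p + snd p = m}. {q. fst q + snd q = snd p}).
        ?t (fst p) (fst q) (snd q))"
      by (rule sum.reindex_bij_witness[of _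
            "\<lambda>((a, d), (b, c)). ((a + b, c), (a, b))" "\<lambda>((d, c), (a, b)). ((a, b + c), (b, c))"])
         (auto simp: add.assoc)
    also have "\<dots> = (\<Sum>p | fst p + snd p = m. \<Sum>q | fst q + snd q = snd p. ?t (fst p) (fst q) (snd q))"
      using finite_splits by (subst sum.Sigma) (auto simp: case_prod_unfold)
    also have "\<dots> = mfps_nth (f * (g * h)) m"
      by (simp add: times_mfps_def case_prod_unfold sum_distrib_left mult.assoc)
    finally show "mfps_nth (f * g * h) m = mfps_nth (f * (g * h)) m" .
  qed
  show "f * g = g * f"
    unfolding times_mfps_def
    by (rule arg_cong[where f = Abs_mfps], rule ext,
        rule sum.reindex_bij_witness[of _ prod.swap prod.swap]) (auto simp: add.commute mult.commute)
  show "1 * f = f"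
  proof (rule mfps_eqI)
    fix m :: "nat ^ 'b"
    have "mfps_nth (1 * f) m = (\<Sum>(a, b) \<in> {(0 :: nat ^ 'b, m)}. (if a = 0 then 1 else 0) * mfps_nth f b)"
      unfolding times_mfps_def one_mfps_def mfps_nth_Abs
      by (rule sum.mono_neutral_right[OF finite_splits]) (auto split: if_splits)
    then show "mfps_nth (1 * f) m = mfps_nth f m" by simp
  qed
  show "(f + g) * h = f * h + g * h"
    by (rule mfps_eqI)
       (simp add: times_mfps_def plus_mfps_def case_prod_beta distrib_right sum.distrib)
  show "(0 :: ('a, 'b) mfps) \<noteq> 1"
    by (auto simp: zero_mfps_def one_mfps_def Abs_mfps_inject fun_eq_iff)
qed (auto intro!: mfps_eqI simp: zero_mfps_def plus_mfps_def minus_mfps_def uminus_mfps_def)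

end

lemma mfps_nth_add [simp]: "mfps_nth (f + g) m = mfps_nth f m + mfps_nth g m"
  and mfps_nth_diff [simp]: "mfps_nth (f - g) m = mfps_nth f m - mfps_nth g m"
  and mfps_nth_uminus [simp]: "mfps_nth (- f) m = - mfps_nth f m"
  and mfps_nth_zero [simp]: "mfps_nth 0 m = 0"
  and mfps_nth_one: "mfps_nth 1 m = (if m = 0 then 1 else 0)"
  by (simp_all add: zero_mfps_def one_mfps_def plus_mfps_def minus_mfps_def uminus_mfps_def)

lemma mfps_nth_mult:
  "mfps_nth (f * g) m = (\<Sum>(a, b) | a + b = m. mfps_nth f a * mfps_nth g b)"
  by (simp add: times_mfps_def)

lemma mfps_nth_mult_0 [simp]: "mfps_nth (f * g) 0 = mfps_nth f 0 * mfps_nth g 0"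
proof -
  have "{(a, b). a + b = (0 :: nat ^ 'b)} = {(0, 0)}" by (auto simp: vec_eq_iff)
  then show ?thesis by (simp add: mfps_nth_mult)
qed

definition mfps_const :: "'a \<Rightarrow> ('a :: comm_ring_1, 'v :: finite) mfps" where
  "mfps_const c = Abs_mfps (\<lambda>m. if m = 0 then c else 0)"

definition mfps_X :: "'v \<Rightarrow> ('a :: comm_ring_1, 'v :: finite) mfps" where
  "mfps_X v = Abs_mfps (\<lambda>m. if m = axis v 1 then 1 else 0)"

definition mfps_deriv :: "'v \<Rightarrow> ('a :: comm_ring_1, 'v :: finite) mfps \<Rightarrow> ('a, 'v) mfps" where
  "mfps_deriv v f = Abs_mfps (\<lambda>m. of_nat (m $ v + 1) * mfps_nth f (m + axis v 1))"

definition mfps_hom_part :: "nat \<Rightarrow> ('a :: comm_ring_1, 'v :: finite) mfps \<Rightarrow> ('a, 'v) mfps" where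
  "mfps_hom_part d f = Abs_mfps (\<lambda>m. if mdeg m = d then mfps_nth f m else 0)"

text \<open>The substitution \<open>x\<^sub>v \<mapsto> c\<^sub>v x\<^sub>v\<close>; see \<open>mfps_compose_scaled_vars\<close> below.\<close>

definition mfps_scale :: "('v \<Rightarrow> 'a) \<Rightarrow> ('a :: comm_ring_1, 'v :: finite) mfps \<Rightarrow> ('a, 'v) mfps" where
  "mfps_scale c f = Abs_mfps (\<lambda>m. (\<Prod>v\<in>UNIV. c v ^ (m $ v)) * mfps_nth f m)"

text \<open>Substitution of the series \<open>u v\<close> for the variables \<open>v\<close>, meant for \<open>u v\<close> without constant
  term. As for the composition of univariate series in the library, the sum is cut off where all
  further terms vanish (\<open>mfps_nth_monomial_eq_0\<close>).\<close>

definition mfps_compose ::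
    "('a :: comm_ring_1, 'v :: finite) mfps \<Rightarrow> ('v \<Rightarrow> ('a, 'w :: finite) mfps) \<Rightarrow> ('a, 'w) mfps" where
  "mfps_compose f u =
     Abs_mfps (\<lambda>m. \<Sum>s | mdeg s \<le> mdeg m. mfps_nth f s * mfps_nth (\<Prod>v\<in>UNIV. u v ^ (s $ v)) m)"

definition mfps_sqrt :: "(complex, 'v :: finite) mfps \<Rightarrow> (complex, 'v) mfps" where
  "mfps_sqrt f = (THE g. g ^ 2 = f \<and> mfps_nth g 0 = csqrt (mfps_nth f 0))"

instantiation mfps :: (field, finite) inverse
begin

definition inverse_mfps :: "('a, 'b) mfps \<Rightarrow> ('a, 'b) mfps" where
  "inverse f = (if mfps_nth f 0 = 0 then 0 else THE g. f * g = 1)"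
definition divide_mfps :: "('a, 'b) mfps \<Rightarrow> ('a, 'b) mfps \<Rightarrow> ('a, 'b) mfps" where
  "f div g = f * inverse (g :: ('a, 'b) mfps)"

instance ..

end


subsection \<open>Adequacy of composition, inverse and square root\<close>

lemma mfps_nth_mult_eq_0:
  fixes f g :: "('a :: comm_ring_1, 'v :: finite) mfps"
  assumes "\<And>a. mdeg a < i \<Longrightarrow> mfps_nth f a = 0" and "\<And>b. mdeg b < j \<Longrightarrow> mfps_nth g b = 0"
    and "mdeg m < i + j"
  shows "mfps_nth (f * g) m = 0"
  unfolding mfps_nth_mult
proof (rule sum.neutral, clarify)
  fix a b :: "nat ^ 'v" assume "m = a + b"
  with assms(3) have "mdeg a < i \<or> mdeg b < j" by auto
  with assms(1,2) show "mfps_nth f a * mfps_nth g b = 0" by auto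
qed

lemma mfps_nth_power_eq_0:
  assumes "mfps_nth f 0 = 0" and "mdeg m < k"
  shows "mfps_nth (f ^ k) m = 0"
  using assms(2)
proof (induction k arbitrary: m)
  case (Suc k)
  show ?case unfolding power_Suc
    by (rule mfps_nth_mult_eq_0[of 1 _ k]) (use Suc assms(1) in auto)
qed auto

lemma mfps_nth_monomial_eq_0:
  fixes u :: "'v :: finite \<Rightarrow> ('a :: comm_ring_1, 'w :: finite) mfps"
  assumes "\<And>v. mfps_nth (u v) 0 = 0" and "mdeg m < mdeg s"
  shows "mfps_nth (\<Prod>v\<in>UNIV. u v ^ (s $ v)) m = 0"
proof -
  have "mfps_nth (\<Prod>v\<in>V. u v ^ (s $ v)) m = 0" if "finite V" "mdeg m < (\<Sum>v\<in>V. s $ v)" for V m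
    using that
  proof (induction V arbitrary: m rule: finite_induct)
    case (insert v V)
    have "mfps_nth (u v ^ (s $ v) * (\<Prod>v\<in>V. u v ^ (s $ v))) m = 0"
      by (rule mfps_nth_mult_eq_0[of "s $ v" _ "\<Sum>v\<in>V. s $ v"])
         (use insert mfps_nth_power_eq_0[OF assms(1)] in auto)
    with insert.hyps show ?case by simp
  qed auto
  from this[of UNIV m] assms(2) show ?thesis by (simp add: mdeg_def)
qed

lemma mfps_nth_compose:
  assumes "\<And>v. mfps_nth (u v) 0 = 0" and "finite S" and "{s. mdeg s \<le> mdeg m} \<subseteq> S"
  shows "mfps_nth (mfps_compose f u) m
       = (\<Sum>s\<in>S. mfps_nth f s * mfps_nth (\<Prod>v\<in>UNIV. u v ^ (s $ v)) m)"
  unfolding mfps_compose_def mfps_nth_Abs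
proof (rule sum.mono_neutral_left[OF assms(2,3)], rule ballI)
  fix s assume "s \<in> S - {s. mdeg s \<le> mdeg m}"
  then show "mfps_nth f s * mfps_nth (\<Prod>v\<in>UNIV. u v ^ (s $ v)) m = 0"
    using mfps_nth_monomial_eq_0[of u m s, OF assms(1)] by auto
qed

lemma mfps_monomial_mult:
  "Abs_mfps (\<lambda>m. if m = s then c else 0) * Abs_mfps (\<lambda>m. if m = t then d else 0)
   = Abs_mfps (\<lambda>m. if m = s + t then c * d else (0 :: 'a :: comm_ring_1))"
proof (rule mfps_eqI)
  fix m :: "nat ^ 'b"
  have "(\<Sum>(a, b) | a + b = m. (if a = s then c else 0) * (if b = t then d else 0))
      = (\<Sum>(a, b) \<in> {(s, t)} \<inter> {(a, b). a + b = m}. c * d)"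
    by (rule sum.mono_neutral_cong_right) (auto split: if_splits)
  also have "\<dots> = (if m = s + t then c * d else 0)"
    by (cases "m = s + t") auto
  finally show "mfps_nth (Abs_mfps (\<lambda>m. if m = s then c else 0) * Abs_mfps (\<lambda>m. if m = t then d else 0)) m
      = mfps_nth (Abs_mfps (\<lambda>m. if m = s + t then c * d else 0)) m"
    by (simp add: mfps_nth_mult)
qed

lemma mfps_scaled_var_power:
  "(mfps_const c * mfps_X v) ^ k = Abs_mfps (\<lambda>m. if m = axis v k then c ^ k else 0)"
proof (induction k)
  case 0
  show ?case by (rule mfps_eqI) (simp add: mfps_nth_one)
next
  case (Suc k)
  have "axis v 1 + axis v k = (axis v (Suc k) :: nat ^ 'b)"
    by (simp add: axis_def vec_eq_iff)
  then show ?case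
    unfolding power_Suc Suc
    by (simp add: mfps_const_def mfps_X_def mfps_monomial_mult cong: if_cong)
qed

lemma mfps_compose_scaled_vars:
  fixes f :: "('a :: comm_ring_1, 'v :: finite) mfps"
  shows "mfps_compose f (\<lambda>v. mfps_const (c v) * mfps_X v) = mfps_scale c f"
proof (rule mfps_eqI)
  fix m :: "nat ^ 'v"
  have *: "(\<Prod>v\<in>V. (mfps_const (c v) * mfps_X v) ^ (s $ v))
      = Abs_mfps (\<lambda>m. if m = (\<Sum>v\<in>V. axis v (s $ v)) then \<Prod>v\<in>V. c v ^ (s $ v) else 0)"
    if "finite V" for V and s :: "nat ^ 'v"
    using that
  proof (induction V rule: finite_induct)
    case empty
    show ?case by (rule mfps_eqI) (simp add: mfps_nth_one)
  qed (simp add: mfps_scaled_var_power mfps_monomial_mult cong: if_cong)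
  have **: "(\<Sum>v\<in>UNIV. axis v (s $ v)) = s" for s :: "nat ^ 'v"
    by (simp add: vec_eq_iff axis_def if_distrib cong: if_cong)
  have "mfps_nth (mfps_compose f (\<lambda>v. mfps_const (c v) * mfps_X v)) m
      = (\<Sum>s | mdeg s \<le> mdeg m. if m = s then mfps_nth f s * (\<Prod>v\<in>UNIV. c v ^ (s $ v)) else 0)"
    unfolding mfps_compose_def by (simp add: * ** if_distrib cong: if_cong)
  also have "\<dots> = mfps_nth (mfps_scale c f) m"
    by (simp add: mfps_scale_def mult.commute)
  finally show "mfps_nth (mfps_compose f (\<lambda>v. mfps_const (c v) * mfps_X v)) m
      = mfps_nth (mfps_scale c f) m" .
qed

function mfps_inv_coeff :: "('a :: field, 'v :: finite) mfps \<Rightarrow> nat ^ 'v \<Rightarrow> 'a" where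
  "mfps_inv_coeff f m =
     ((if m = 0 then 1 else 0)
       - (\<Sum>(a, b) | a + b = m \<and> a \<noteq> 0. mfps_nth f a * mfps_inv_coeff f b)) / mfps_nth f 0"
  by pat_completeness auto
termination
  by (relation "Wellfounded.measure (\<lambda>(f, m). mdeg m)") (auto simp flip: mdeg_eq_0_iff)

declare mfps_inv_coeff.simps [simp del]

lemma mfps_right_inverse:
  fixes f :: "('a :: field, 'v :: finite) mfps"
  assumes "mfps_nth f 0 \<noteq> 0"
  shows "f * inverse f = 1"
proof -
  let ?g = "Abs_mfps (mfps_inv_coeff f)"
  have g: "f * ?g = 1"
  proof (rule mfps_eqI)
    fix m :: "nat ^ 'v"
    have split: "{(a, b). a + b = m} = insert (0, m) {(a, b). a + b = m \<and> a \<noteq> 0}" by auto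
    have "finite {(a, b). a + b = m \<and> a \<noteq> 0}" by (rule finite_subset[OF _ finite_splits[of m]]) auto
    then have "mfps_nth (f * ?g) m = mfps_nth f 0 * mfps_inv_coeff f m
        + (\<Sum>(a, b) | a + b = m \<and> a \<noteq> 0. mfps_nth f a * mfps_inv_coeff f b)"
      by (simp add: mfps_nth_mult split)
    also have "\<dots> = mfps_nth 1 m"
      by (subst mfps_inv_coeff.simps) (simp add: assms mfps_nth_one)
    finally show "mfps_nth (f * ?g) m = mfps_nth 1 m" .
  qed
  moreover have "h = ?g" if "f * h = 1" for h
  proof -
    have "h = h * (f * ?g)" by (simp only: g mult_1_right)
    also have "\<dots> = (f * h) * ?g" by (simp only: mult_ac)
    also have "\<dots> = ?g" by (simp only: that mult_1_left)
    finally show ?thesis .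
  qed
  ultimately have "f * (THE g. f * g = 1) = 1" by (rule theI)
  then show ?thesis by (simp add: inverse_mfps_def assms)
qed

function mfps_sqrt_coeff :: "complex \<Rightarrow> (complex, 'v :: finite) mfps \<Rightarrow> nat ^ 'v \<Rightarrow> complex" where
  "mfps_sqrt_coeff c f m =
     (if m = 0 then c
      else (mfps_nth f m - (\<Sum>(a, b) | a + b = m \<and> a \<noteq> 0 \<and> b \<noteq> 0.
              mfps_sqrt_coeff c f a * mfps_sqrt_coeff c f b)) / (2 * c))"
  by pat_completeness auto
termination
  by (relation "Wellfounded.measure (\<lambda>(c, f, m). mdeg m)") (auto simp flip: mdeg_eq_0_iff)

declare mfps_sqrt_coeff.simps [simp del]

lemma mfps_sqrt:
  fixes f :: "(complex, 'v :: finite) mfps"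
  assumes "mfps_nth f 0 \<noteq> 0"
  shows "mfps_sqrt f ^ 2 = f" and "mfps_nth (mfps_sqrt f) 0 = csqrt (mfps_nth f 0)"
proof -
  define c where "c = csqrt (mfps_nth f 0)"
  have c: "c \<noteq> 0" "c * c = mfps_nth f 0"
    using assms power2_csqrt[of "mfps_nth f 0"] by (auto simp: c_def power2_eq_square)
  let ?g = "Abs_mfps (mfps_sqrt_coeff c f)"
  have g0: "mfps_sqrt_coeff c f 0 = c" by (subst mfps_sqrt_coeff.simps) simp
  have g: "?g ^ 2 = f"
  proof (rule mfps_eqI)
    fix m :: "nat ^ 'v"
    show "mfps_nth (?g ^ 2) m = mfps_nth f m"
    proof (cases "m = 0")
      case True
      then show ?thesis by (simp add: power2_eq_square g0 c)
    next
      case False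
      let ?R = "{(a, b). a + b = m \<and> a \<noteq> 0 \<and> b \<noteq> 0}"
      have split: "{(a, b). a + b = m} = insert (0, m) (insert (m, 0) ?R)" by auto
      have "finite ?R" by (rule finite_subset[OF _ finite_splits[of m]]) auto
      then have "mfps_nth (?g ^ 2) m = 2 * c * mfps_sqrt_coeff c f m
          + (\<Sum>(a, b) \<in> ?R. mfps_sqrt_coeff c f a * mfps_sqrt_coeff c f b)"
        using False by (simp add: power2_eq_square mfps_nth_mult split g0)
      also have "\<dots> = mfps_nth f m"
        by (subst mfps_sqrt_coeff.simps) (simp add: False c)
      finally show ?thesis .
    qed
  qed
  moreover have "h = ?g" if h: "h ^ 2 = f \<and> mfps_nth h 0 = c" for h
  proof -
    let ?s = "h + ?g"
    have "mfps_nth ?s 0 \<noteq> 0" using h c by (simp add: g0)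
    then have s: "?s * inverse ?s = 1" by (rule mfps_right_inverse)
    have "(h - ?g) * ?s = h ^ 2 - ?g ^ 2" by (simp add: power2_eq_square algebra_simps)
    also have "\<dots> = 0" using h g by simp
    finally have "(h - ?g) * (?s * inverse ?s) = 0" by (metis mult.assoc mult_zero_left)
    then show ?thesis by (simp only: s mult_1_right right_minus_eq)
  qed
  ultimately have "(THE g. g ^ 2 = f \<and> mfps_nth g 0 = c) ^ 2 = f
      \<and> mfps_nth (THE g. g ^ 2 = f \<and> mfps_nth g 0 = c) 0 = c"
    by (intro theI[where P = "\<lambda>g. g ^ 2 = f \<and> mfps_nth g 0 = c" and a = ?g]) (simp_all add: g0)
  then show "mfps_sqrt f ^ 2 = f" "mfps_nth (mfps_sqrt f) 0 = csqrt (mfps_nth f 0)"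
    by (simp_all add: mfps_sqrt_def c_def)
qed


section \<open>Series in complex coordinates and their conjugates\<close>

text \<open>The variable \<open>z\<^sub>j\<close> is indexed by \<open>Inl j\<close> and its conjugate, treated as an independent
  variable, by \<open>Inr j\<close>.\<close>

type_synonym 'n zseries = "(complex, 'n + 'n) mfps"

text \<open>The exponent of the monomial with exponent \<open>k'\<close> in \<open>z\<close> and \<open>k''\<close> in the conjugate
  variables.\<close>

definition zexp :: "nat ^ 'n \<Rightarrow> nat ^ 'n \<Rightarrow> nat ^ ('n + 'n)" where
  "zexp k' k'' = (\<chi> v. case v of Inl j \<Rightarrow> k' $ j | Inr j \<Rightarrow> k'' $ j)"

definition nonresonant :: "complex ^ 'n \<Rightarrow> bool" where
  "nonresonant lam \<longleftrightarrow> (\<forall>k :: int ^ 'n. (\<Prod>j\<in>UNIV. (lam $ j) powi (k $ j)) = 1 \<longrightarrow> k = 0)"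

definition inv_rot :: "complex ^ 'n \<Rightarrow> complex ^ 'n" where
  "inv_rot lam = (\<chi> j. inverse (lam $ j))"

text \<open>\<open>rot lam g\<close> is \<open>g \<circ> \<rho>\<close>, and \<open>rot (inv_rot lam) g\<close> is \<open>g \<circ> \<rho>\<^sup>-\<^sup>1\<close>.\<close>

definition rot :: "complex ^ 'n \<Rightarrow> 'n zseries \<Rightarrow> 'n zseries" where
  "rot lam = mfps_scale (\<lambda>v. case v of Inl j \<Rightarrow> lam $ j | Inr j \<Rightarrow> inverse (lam $ j))"

text \<open>The operators \<open>\<tau>\<^sub>\<plusminus>\<close>, with a minus sign on \<open>\<chi>\<close> and a plus sign on \<open>f \<circ> \<chi>\<close>. The
  vector \<open>\<mu>\<close> is \<open>lam\<close> for \<open>\<tau>\<^sub>+\<close> and \<open>inv_rot lam\<close> for \<open>\<tau>\<^sub>-\<close>.\<close>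

definition tau_diff :: "complex ^ 'n \<Rightarrow> 'n zseries \<Rightarrow> 'n zseries" where
  "tau_diff \<mu> g = g - rot \<mu> g"

definition tau_sum :: "complex ^ 'n \<Rightarrow> 'n zseries \<Rightarrow> 'n zseries" where
  "tau_sum \<mu> g = g + rot \<mu> g"

definition lagrangian ::
    "(complex, 'n :: finite) mfps \<Rightarrow> ('n \<Rightarrow> 'n zseries) \<Rightarrow> ('n \<Rightarrow> 'n zseries) \<Rightarrow> 'n zseries" where
  "lagrangian f x y =
     mfps_sqrt ((\<Sum>j\<in>UNIV. (x j - y j) ^ 2) + (mfps_compose f x + mfps_compose f y) ^ 2)"

text \<open>Averaging over the torus action, which multiplies \<open>z\<^sub>j\<close> and \<open>dz\<^sub>j\<close> by \<open>e\<^sup>i\<^sup>\<alpha>\<close> with \<open>\<alpha> = \<alpha>\<^sub>j\<close> and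
  their conjugates by the inverse, keeps exactly the invariant terms.\<close>

definition avg :: "('n :: finite) zseries \<Rightarrow> 'n zseries" where
  "avg g = Abs_mfps (\<lambda>m. if \<exists>k. m = zexp k k then mfps_nth g m else 0)"

text \<open>A formal 1-form is the family of its coefficients: \<open>\<omega> (Inl l)\<close> is the coefficient of
  \<open>dz\<^sub>l\<close> and \<open>\<omega> (Inr l)\<close> that of the differential of the conjugate variable.\<close>

type_synonym 'n zform = "'n + 'n \<Rightarrow> 'n zseries"

definition form_d :: "('n :: finite) zseries \<Rightarrow> 'n zform" where
  "form_d g = (\<lambda>v. mfps_deriv v g)"

definition form_avg :: "('n :: finite) zform \<Rightarrow> 'n zform" where
  "form_avg \<omega> = (\<lambda>v. case v of
     Inl j \<Rightarrow> Abs_mfps (\<lambda>m. if \<exists>k k'. m = zexp k k' \<and> k + axis j 1 = k' then mfps_nth (\<omega> v) m else 0)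
   | Inr j \<Rightarrow> Abs_mfps (\<lambda>m. if \<exists>k k'. m = zexp k k' \<and> k = k' + axis j 1 then mfps_nth (\<omega> v) m else 0))"

definition form_bracket :: "('n :: finite) zform \<Rightarrow> 'n zform" where
  "form_bracket \<omega> = (\<lambda>v. \<omega> v - form_avg \<omega> v)"

definition jacobian_at_0 :: "('n + 'n \<Rightarrow> ('n :: finite) zseries) \<Rightarrow> complex ^ ('n + 'n) ^ ('n + 'n)" where
  "jacobian_at_0 u = (\<chi> i v. mfps_nth (mfps_deriv v (u i)) 0)"

definition billiard_form ::
    "complex ^ 'n \<Rightarrow> (complex, 'n :: finite) mfps \<Rightarrow> ('n \<Rightarrow> 'n zseries) \<Rightarrow> 'n zform" where
  "billiard_form lam f chi = (\<lambda>v. \<Sum>j\<in>UNIV.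
     ((tau_diff (inv_rot lam) (chi j)
         + tau_sum (inv_rot lam) (mfps_compose f chi) * mfps_compose (mfps_deriv j f) chi)
        / lagrangian f (\<lambda>i. rot (inv_rot lam) (chi i)) chi
    + (tau_diff lam (chi j)
         + tau_sum lam (mfps_compose f chi) * mfps_compose (mfps_deriv j f) chi)
        / lagrangian f chi (\<lambda>i. rot lam (chi i)))
     * form_d (chi j) v)"

end

theory Submission imports Defs begin

text \<open>
  Write \<open>\<chi>\<^sub>\<plusminus> = \<chi> \<circ> \<rho>\<^sup>\<plusminus>\<close> for the neighbours of \<open>\<chi>\<close> on its orbit, \<open>G = L(\<chi>\<^sub>-, \<chi>)\<close>, and
  \<open>W\<^sub>j = \<partial>\<^sub>y\<^sub>j L(\<chi>\<^sub>-, \<chi>) + \<partial>\<^sub>x\<^sub>j L(\<chi>, \<chi>\<^sub>+)\<close> for the Euler-Lagrange expressions of the billiard.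
  The form in the first equation of the system is \<open>\<omega> = \<Sum>\<^sub>j W\<^sub>j d\<chi>\<^sub>j\<close>. Averages do not change under
  rotation, so \<open>\<langle>\<omega>\<rangle> = \<langle>dG\<rangle> = d\<langle>G\<rangle>\<close> (lemma \<open>billiard_form_balanced\<close>). The two equations of the
  system together therefore follow from \<open>W = 0\<close>: the form vanishes, and \<open>\<langle>G\<rangle>\<close> has no
  coefficient except its constant term \<open>L(0,0)\<close>.

  The equation \<open>W = 0\<close> is solved degree by degree, by pairs \<open>(f, \<chi>)\<close> that are real, with \<open>f\<close>
  even in each variable and \<open>\<chi>\<close> odd. Let such a pair solve it below the odd degree \<open>d\<close>. Adding to
  \<open>\<chi>\<^sub>j\<close> a term \<open>\<eta>\<^sub>j\<close> of degree \<open>d\<close> and to \<open>f\<close> a term \<open>\<phi>\<close> of degree \<open>d + 1\<close> changes the terms of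
  degree \<open>d\<close> of \<open>W\<^sub>j\<close> by a multiple of \<open>D\<^sub>j \<eta>\<^sub>j + 4 f\<^sub>0 (\<partial>\<^sub>j \<phi>)(\<chi>\<^sup>(\<^sup>1\<^sup>))\<close> (lemma
  \<open>euler_lagrange_linearize\<close>). The operator \<open>D\<^sub>j\<close> is diagonal on monomials.
  If the rotation multiplies a monomial by \<open>\<mu>\<close>, its eigenvalue is \<open>\<lambda>\<^sub>j + \<lambda>\<^sub>j\<^sup>-\<^sup>1 - \<mu> - \<mu>\<^sup>-\<^sup>1\<close>, owing to the
  choice of \<open>f\<^sup>(\<^sup>2\<^sup>)\<close>. By nonresonance the eigenvalue is zero only on the monomials which turn into some \<open>z\<^sup>s\<close>
  times its conjugate on multiplication by \<open>z\<^sub>j\<close> or by its conjugate (lemma \<open>eigval_eq_0\<close>).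

  These resonant terms cannot be changed by \<open>\<eta>\<close>, and there are many more of them than there
  are coefficients of \<open>\<phi>\<close>. What saves the argument is the variational structure: \<open>\<langle>\<omega>\<rangle> = d\<langle>G\<rangle>\<close> says
  that all resonant coefficients of all the \<open>W\<^sub>j\<close> are determined by the numbers \<open>g\<^sub>s\<close>, the
  coefficients of \<open>\<langle>G\<rangle>\<close>, one for each \<open>s\<close> with \<open>2 \<parallel>s\<parallel> = d + 1\<close>. By the chain rule the resonant
  coefficients of \<open>(\<partial>\<^sub>j \<phi>)(\<chi>\<^sup>(\<^sup>1\<^sup>))\<close> depend in the same way on the balanced coefficients of
  \<open>\<phi>(\<chi>\<^sup>(\<^sup>1\<^sup>))\<close>, and those are \<open>\<phi>\<^sub>2\<^sub>s\<close> times a positive number (lemmas \<open>nth_compose_chi1\<close> and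
  \<open>diag_coeff_real_nonzero\<close>). Hence one real number \<open>\<phi>\<^sub>2\<^sub>s\<close> for each \<open>s\<close> removes all resonant terms, and
  \<open>\<eta>\<close> removes the others (lemma \<open>raise_order\<close>). Oddness of \<open>W\<close> takes care of even degrees. The
  successive corrections have increasing order, so that the pairs converge coefficientwise.
\<close>

section \<open>The filtration of power series by order\<close>

text \<open>Congruence modulo \<open>ord_ge d\<close> is equality of all terms of degree below \<open>d\<close>. Sums,
  products, inverses, square roots and compositions respect these congruences, and a series congruent to \<open>0\<close> for every \<open>d\<close> vanishes; this
  replaces topological arguments.\<close>
definition ord_ge :: "nat \<Rightarrow> ('a :: comm_ring_1, 'v :: finite) mfps set" where
  "ord_ge d = {f. \<forall>m. mdeg m < d \<longrightarrow> mfps_nth f m = 0}"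

lemma ord_geI: "(\<And>m. mdeg m < d \<Longrightarrow> mfps_nth f m = 0) \<Longrightarrow> f \<in> ord_ge d"
  by (simp add: ord_ge_def)

lemma ord_geD: "f \<in> ord_ge d \<Longrightarrow> mdeg m < d \<Longrightarrow> mfps_nth f m = 0"
  by (simp add: ord_ge_def)

lemma ord_ge_diffD: "f - g \<in> ord_ge d \<Longrightarrow> mdeg m < d \<Longrightarrow> mfps_nth f m = mfps_nth g m"
  by (drule (1) ord_geD) simp

lemma ord_ge_0 [simp]: "ord_ge 0 = UNIV"
  by (simp add: ord_ge_def)

lemma ord_ge_1_iff: "f \<in> ord_ge 1 \<longleftrightarrow> mfps_nth f 0 = 0"
  by (auto simp: ord_ge_def)

lemma zero_ord_ge [simp]: "0 \<in> ord_ge d"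
  by (simp add: ord_ge_def)

lemma ord_ge_add: "f \<in> ord_ge d \<Longrightarrow> g \<in> ord_ge d \<Longrightarrow> f + g \<in> ord_ge d"
  and ord_ge_diff: "f \<in> ord_ge d \<Longrightarrow> g \<in> ord_ge d \<Longrightarrow> f - g \<in> ord_ge d"
  and ord_ge_uminus: "f \<in> ord_ge d \<Longrightarrow> - f \<in> ord_ge d"
  and ord_ge_mono: "f \<in> ord_ge d \<Longrightarrow> d' \<le> d \<Longrightarrow> f \<in> ord_ge d'"
  by (simp_all add: ord_ge_def)

lemma ord_ge_sum: "(\<And>i. i \<in> A \<Longrightarrow> f i \<in> ord_ge d) \<Longrightarrow> sum f A \<in> ord_ge d"
  by (induction A rule: infinite_finite_induct) (auto intro: ord_ge_add)

lemma ord_ge_mult: "f \<in> ord_ge i \<Longrightarrow> g \<in> ord_ge j \<Longrightarrow> f * g \<in> ord_ge (i + j)"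
  by (rule ord_geI, rule mfps_nth_mult_eq_0) (auto dest: ord_geD)

lemma ord_ge_mult_left: "f \<in> ord_ge i \<Longrightarrow> f * g \<in> ord_ge i"
  and ord_ge_mult_right: "g \<in> ord_ge i \<Longrightarrow> f * g \<in> ord_ge i"
  using ord_ge_mult[of f i g 0] ord_ge_mult[of f 0 g i] by simp_all

lemma eq_if_diff_ord_ge:
  assumes "\<And>d. f - g \<in> ord_ge d" shows "f = g"
proof (rule mfps_eqI)
  fix m show "mfps_nth f m = mfps_nth g m"
    using assms[of "Suc (mdeg m)"] by (rule ord_ge_diffD) simp
qed

lemma ord_ge_trans: "f - g \<in> ord_ge d \<Longrightarrow> g - h \<in> ord_ge d \<Longrightarrow> f - h \<in> ord_ge d"
  using ord_ge_add[of "f - g" d "g - h"] by simp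

lemma ord_ge_diff_commute: "f - g \<in> ord_ge d \<Longrightarrow> g - f \<in> ord_ge d"
  using ord_ge_uminus[of "f - g" d] by simp

lemma mfps_nth_sum [simp]: "mfps_nth (sum f A) m = (\<Sum>i\<in>A. mfps_nth (f i) m)"
  by (induction A rule: infinite_finite_induct) auto

lemma mfps_nth_const: "mfps_nth (mfps_const c) m = (if m = 0 then c else 0)"
  by (simp add: mfps_const_def)

lemma mfps_nth_const_mult [simp]: "mfps_nth (mfps_const c * f) m = c * mfps_nth f m"
proof -
  have "mfps_nth (mfps_const c * f) m
      = (\<Sum>(a, b) \<in> {(0 :: nat ^ 'b, m)}. (if a = 0 then c else 0) * mfps_nth f b)"
    unfolding mfps_nth_mult mfps_nth_const
    by (rule sum.mono_neutral_right[OF finite_splits]) (auto split: if_splits)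
  then show ?thesis by simp
qed

lemma mfps_const_add: "mfps_const (c + d) = mfps_const c + mfps_const d"
  and mfps_const_uminus: "mfps_const (- c) = - mfps_const c"
  and mfps_const_0 [simp]: "mfps_const 0 = 0"
  and mfps_const_1 [simp]: "mfps_const 1 = 1"
  and mfps_const_mult: "mfps_const (c * d) = mfps_const c * mfps_const d"
  by (rule mfps_eqI; simp add: mfps_nth_const mfps_nth_one)+

lemma mfps_const_numeral: "mfps_const (numeral k) = numeral k"
proof -
  have "mfps_const (of_nat n) = of_nat n" for n
    by (induction n) (simp_all add: mfps_const_add)
  from this[of "numeral k"] show ?thesis by simp
qed

lemma mfps_const_power: "mfps_const (c ^ k) = mfps_const c ^ k"
  by (induction k) (simp_all add: mfps_const_mult)

lemma mfps_const_of_nat: "mfps_const (of_nat n) = of_nat n"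
  by (induction n) (simp_all add: mfps_const_add)

lemma ord_ge_minus_const: "f - mfps_const (mfps_nth f 0) \<in> ord_ge 1"
  unfolding ord_ge_1_iff by (simp add: mfps_nth_const)

lemma ord_ge_mult_diff:
  assumes "f - f' \<in> ord_ge d" "g - g' \<in> ord_ge d"
  shows "f * g - f' * g' \<in> ord_ge d"
proof -
  have "f * g - f' * g' = (f - f') * g + f' * (g - g')" by (simp add: algebra_simps)
  then show "f * g - f' * g' \<in> ord_ge d"
    by (simp add: ord_ge_add ord_ge_mult_left ord_ge_mult_right assms)
qed

text \<open>All other contributions to this coefficient pair a positive-degree term of \<open>g\<close> with a term of
  \<open>f\<close> below its order.\<close>
lemma mfps_nth_mult_lowest:
  assumes "f \<in> ord_ge (mdeg m)"
  shows "mfps_nth (f * g) m = mfps_nth f m * mfps_nth g 0"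
proof -
  have "f * (g - mfps_const (mfps_nth g 0)) \<in> ord_ge (mdeg m + 1)"
    by (intro ord_ge_mult assms ord_ge_minus_const)
  then have "mfps_nth (f * g) m = mfps_nth (mfps_const (mfps_nth g 0) * f) m"
    by (intro ord_ge_diffD[of _ _ "mdeg m + 1"]) (simp_all add: algebra_simps del: mfps_nth_const_mult)
  also have "\<dots> = mfps_nth f m * mfps_nth g 0" unfolding mult.commute[of f] by simp
  finally show ?thesis .
qed

lemma ord_ge_odd:
  assumes "g \<in> ord_ge (2 * k)" "\<And>m. mfps_nth g m \<noteq> 0 \<Longrightarrow> odd (mdeg m)"
  shows "g \<in> ord_ge (2 * k + 1)"
  by (rule ord_geI) (use assms in \<open>metis ord_geD less_Suc_eq Suc_eq_plus1 dvd_triv_left\<close>)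

section \<open>Inverses and square roots\<close>

lemma mfps_mult_left_cancel:
  fixes f :: "('a :: field, 'v :: finite) mfps"
  assumes "mfps_nth f 0 \<noteq> 0" "f * g = f * h"
  shows "g = h"
proof -
  have "(f * inverse f) * g = (f * inverse f) * h"
    using assms(2) by (metis mult.assoc mult.commute)
  then show ?thesis using mfps_right_inverse[OF assms(1)] by simp
qed

lemma mfps_sqrt_unique:
  assumes "g ^ 2 = f" "mfps_nth g 0 = csqrt (mfps_nth f 0)" "mfps_nth f 0 \<noteq> 0"
  shows "mfps_sqrt f = g"
proof -
  let ?s = "mfps_sqrt f + g"
  have "?s * (mfps_sqrt f - g) = mfps_sqrt f ^ 2 - g ^ 2"
    by (simp add: power2_eq_square algebra_simps)
  also have "\<dots> = ?s * 0" using assms mfps_sqrt[OF assms(3)] by simp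
  finally have "mfps_sqrt f - g = 0"
    by (rule mfps_mult_left_cancel[rotated]) (use assms mfps_sqrt[OF assms(3)] in simp)
  then show ?thesis by simp
qed

lemma mfps_inverse_unique:
  fixes f :: "('a :: field, 'v :: finite) mfps"
  assumes "f * g = 1" shows "inverse f = g"
proof -
  have "mfps_nth f 0 * mfps_nth g 0 = 1"
    using arg_cong[OF assms, of "\<lambda>h. mfps_nth h 0"] by (simp add: mfps_nth_one)
  then have "mfps_nth f 0 \<noteq> 0" by auto
  then show ?thesis
    using mfps_right_inverse[of f] assms mfps_mult_left_cancel by metis
qed

lemma mfps_nth_inverse_0:
  fixes f :: "('a :: field, 'v :: finite) mfps"
  assumes "mfps_nth f 0 \<noteq> 0"
  shows "mfps_nth (inverse f) 0 = inverse (mfps_nth f 0)"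
  using arg_cong[OF mfps_right_inverse[OF assms], of "\<lambda>h. mfps_nth h 0"] assms
  by (simp add: mfps_nth_one field_simps)

text \<open>Because \<open>f\<^sup>-\<^sup>1 - g\<^sup>-\<^sup>1 = (g - f) f\<^sup>-\<^sup>1 g\<^sup>-\<^sup>1\<close>.\<close>
lemma ord_ge_inverse_diff:
  fixes f g :: "('a :: field, 'v :: finite) mfps"
  assumes "mfps_nth f 0 \<noteq> 0" "mfps_nth g 0 \<noteq> 0" "f - g \<in> ord_ge d"
  shows "inverse f - inverse g \<in> ord_ge d"
proof -
  have "(f - g) * (inverse f * inverse g)
      = (f * inverse f) * inverse g - (g * inverse g) * inverse f"
    by (simp add: algebra_simps)
  then have "inverse f - inverse g = - ((f - g) * (inverse f * inverse g))"
    using assms by (simp add: mfps_right_inverse)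
  then show ?thesis using assms(3) by (auto intro: ord_ge_uminus ord_ge_mult_left)
qed

text \<open>The sum \<open>\<surd>f + \<surd>g\<close> has nonzero constant term \<open>2 \<surd>(g\<^sub>0)\<close>, so \<open>f - g = (\<surd>f - \<surd>g) (\<surd>f + \<surd>g)\<close> can
  be divided by it.\<close>
lemma ord_ge_sqrt_diff:
  assumes "mfps_nth f 0 = mfps_nth g 0" "mfps_nth g 0 \<noteq> 0" "f - g \<in> ord_ge d"
  shows "mfps_sqrt f - mfps_sqrt g \<in> ord_ge d"
proof -
  let ?s = "mfps_sqrt f + mfps_sqrt g"
  have s: "mfps_nth ?s 0 \<noteq> 0" using assms mfps_sqrt[of f] mfps_sqrt[of g] by simp
  have "(mfps_sqrt f - mfps_sqrt g) * ?s = f - g"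
    using assms mfps_sqrt(1)[of f] mfps_sqrt(1)[of g] by (simp add: power2_eq_square algebra_simps)
  then have "(mfps_sqrt f - mfps_sqrt g) * (?s * inverse ?s) = (f - g) * inverse ?s"
    by (metis mult.assoc)
  then have "mfps_sqrt f - mfps_sqrt g = (f - g) * inverse ?s"
    by (simp only: mfps_right_inverse[OF s] mult_1_right)
  then show ?thesis using assms(3) by (simp add: ord_ge_mult_left)
qed

section \<open>Partial derivatives\<close>

lemma mfps_nth_deriv: "mfps_nth (mfps_deriv v f) m = of_nat (m $ v + 1) * mfps_nth f (m + axis v 1)"
  by (simp add: mfps_deriv_def)

lemma mfps_deriv_add: "mfps_deriv v (f + g) = mfps_deriv v f + mfps_deriv v g"
  and mfps_deriv_diff: "mfps_deriv v (f - g) = mfps_deriv v f - mfps_deriv v g"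
  and mfps_deriv_const_mult: "mfps_deriv v (mfps_const c * f) = mfps_const c * mfps_deriv v f"
  by (rule mfps_eqI; simp add: mfps_nth_deriv ring_distribs mult.left_commute)+

lemma mfps_deriv_0 [simp]: "mfps_deriv v 0 = 0"
  by (rule mfps_eqI) (simp add: mfps_nth_deriv)

lemma mdeg_axis [simp]: "mdeg (axis v k) = k"
  by (simp add: mdeg_def axis_def)

lemma mfps_deriv_const [simp]: "mfps_deriv v (mfps_const c) = 0"
  by (rule mfps_eqI) (simp add: mfps_nth_deriv mfps_nth_const flip: mdeg_eq_0_iff)

lemma mfps_deriv_sum: "mfps_deriv v (sum f A) = (\<Sum>i\<in>A. mfps_deriv v (f i))"
  by (induction A rule: infinite_finite_induct) (auto simp: mfps_deriv_add)

lemma mfps_deriv_X: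
  "mfps_deriv v (mfps_X w) = (if v = w then 1 else (0 :: ('a :: comm_ring_1, 'v :: finite) mfps))"
proof (rule mfps_eqI)
  fix m :: "nat ^ 'v"
  have "m + axis v 1 = axis w 1 \<longleftrightarrow> m = 0 \<and> v = w"
  proof
    assume *: "m + axis v 1 = axis w 1"
    have "mdeg m + 1 = 1" using arg_cong[OF *, of mdeg] by simp
    then have "m = 0" by simp
    with * show "m = 0 \<and> v = w" by (simp add: axis_eq_axis)
  qed auto
  then show "mfps_nth (mfps_deriv v (mfps_X w) :: ('a, 'v) mfps) m = mfps_nth (if v = w then 1 else (0 :: ('a, 'v) mfps)) m"
    by (auto simp: mfps_nth_deriv mfps_X_def mfps_nth_one)
qed

lemma ord_ge_deriv: "f \<in> ord_ge (Suc d) \<Longrightarrow> mfps_deriv v f \<in> ord_ge d"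
  by (rule ord_geI) (simp add: mfps_nth_deriv ord_geD)

lemma eq_add_axis_if_pos: "0 < m $ v \<Longrightarrow> \<exists>m'. m = m' + axis v (1::nat)"
  by (rule exI[of _ "m - axis v 1"]) (simp add: vec_eq_iff axis_def)

text \<open>The coefficient of \<open>\<partial>\<^sub>v (f g)\<close> at \<open>m\<close> is a sum over \<open>a + b = m + e\<^sub>v\<close>, weighted by the \<open>v\<close>-th
  entry of \<open>m + e\<^sub>v\<close>; splitting this weight into those of \<open>a\<close> and of \<open>b\<close> gives the two terms of the
  Leibniz rule.\<close>
lemma mfps_deriv_mult: "mfps_deriv v (f * g) = mfps_deriv v f * g + f * mfps_deriv v g"
proof (rule mfps_eqI)
  fix m :: "nat ^ 'b"
  let ?e = "axis v (1::nat)" and ?M = "m + axis v (1::nat)"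
  have L: "(\<Sum>(a, b) | a + b = ?M. of_nat (a $ v) * (mfps_nth f a * mfps_nth g b))
      = mfps_nth (mfps_deriv v f * g) m" for f g :: "('a, 'b) mfps"
  proof -
    have "(\<Sum>(a, b) | a + b = ?M. of_nat (a $ v) * (mfps_nth f a * mfps_nth g b))
       = (\<Sum>(a, b) | a + b = ?M \<and> a $ v > 0. of_nat (a $ v) * (mfps_nth f a * mfps_nth g b))"
      by (rule sum.mono_neutral_right[OF finite_splits]) (auto intro: gr0I)
    also have "\<dots> = (\<Sum>(a, b) | a + b = m. of_nat (a $ v + 1) * mfps_nth f (a + ?e) * mfps_nth g b)"
      by (rule sum.reindex_bij_witness[of _ "\<lambda>(a, b). (a + ?e, b)" "\<lambda>(a, b). (a - ?e, b)"])
        (auto dest!: eq_add_axis_if_pos simp: add_ac, metis add.assoc add_right_cancel)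
    finally show ?thesis by (simp add: mfps_nth_mult mfps_nth_deriv)
  qed
  have "mfps_nth (mfps_deriv v (f * g)) m
      = (\<Sum>(a, b) | a + b = ?M. of_nat (?M $ v) * (mfps_nth f a * mfps_nth g b))"
    by (simp add: mfps_nth_deriv mfps_nth_mult sum_distrib_left case_prod_unfold)
  also have "\<dots> = (\<Sum>(a, b) | a + b = ?M. of_nat (a $ v) * (mfps_nth f a * mfps_nth g b)
        + of_nat (b $ v) * (mfps_nth f a * mfps_nth g b))"
  proof (rule sum.cong, simp, clarify)
    fix a b assume "a + b = ?M"
    then have "?M $ v = a $ v + b $ v" by (metis vector_add_component)
    then show "of_nat (?M $ v) * (mfps_nth f a * mfps_nth g b) = of_nat (a $ v) * (mfps_nth f a * mfps_nth g b)
        + of_nat (b $ v) * (mfps_nth f a * mfps_nth g b)"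
      by (simp only: of_nat_add distrib_right)
  qed
  also have "\<dots> = mfps_nth (mfps_deriv v f * g) m
      + (\<Sum>(a, b) | a + b = ?M. of_nat (b $ v) * (mfps_nth f a * mfps_nth g b))"
    by (simp add: case_prod_unfold sum.distrib flip: L)
  also have "(\<Sum>(a, b) | a + b = ?M. of_nat (b $ v) * (mfps_nth f a * mfps_nth g b))
      = (\<Sum>(a, b) | a + b = ?M. of_nat (a $ v) * (mfps_nth g a * mfps_nth f b))"
    by (rule sum.reindex_bij_witness[of _ prod.swap prod.swap]) (auto simp: add.commute mult.commute)
  also have "\<dots> = mfps_nth (mfps_deriv v g * f) m" by (rule L)
  finally show "mfps_nth (mfps_deriv v (f * g)) m = mfps_nth (mfps_deriv v f * g + f * mfps_deriv v g) m"
    by (simp add: mult.commute)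
qed

lemma mfps_deriv_1 [simp]: "mfps_deriv v 1 = 0"
  using mfps_deriv_const[of v 1] by simp

lemma mfps_deriv_power: "mfps_deriv v (f ^ k) = of_nat k * f ^ (k - 1) * mfps_deriv v f"
proof (induction k)
  case (Suc k)
  have "of_nat k * f ^ k = of_nat k * (f * f ^ (k - 1))" by (cases k) auto
  then have "f * (of_nat k * f ^ (k - 1) * mfps_deriv v f) = of_nat k * f ^ k * mfps_deriv v f"
    by (simp add: mult_ac)
  with Suc show ?case by (simp add: mfps_deriv_mult algebra_simps)
qed simp

lemma mfps_deriv_prod:
  "finite A \<Longrightarrow> mfps_deriv v (prod f A) = (\<Sum>i\<in>A. mfps_deriv v (f i) * prod f (A - {i}))"
proof (induction A rule: finite_induct)
  case (insert i A)
  have "(\<Sum>j\<in>A. mfps_deriv v (f j) * prod f (insert i A - {j}))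
      = (\<Sum>j\<in>A. f i * (mfps_deriv v (f j) * prod f (A - {j})))"
  proof (rule sum.cong)
    fix j assume "j \<in> A"
    then have "insert i A - {j} = insert i (A - {j})" using insert by auto
    then show "mfps_deriv v (f j) * prod f (insert i A - {j}) = f i * (mfps_deriv v (f j) * prod f (A - {j}))"
      using insert by (simp add: mult_ac)
  qed simp
  with insert show ?case by (simp add: mfps_deriv_mult sum_distrib_left)
qed simp

section \<open>Composition and the chain rule\<close>

abbreviation monom_subst :: "('v :: finite \<Rightarrow> ('a :: comm_ring_1, 'w :: finite) mfps) \<Rightarrow> nat ^ 'v \<Rightarrow> ('a, 'w) mfps" where
  "monom_subst u s \<equiv> \<Prod>v\<in>UNIV. u v ^ (s $ v)"

text \<open>Up to any given degree a composition is a polynomial in the substituted series. Identities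
  for compositions reduce in this way to identities for monomials.\<close>
lemma mfps_compose_approx:
  fixes u :: "'v :: finite \<Rightarrow> ('a :: comm_ring_1, 'w :: finite) mfps"
  assumes "\<And>v. u v \<in> ord_ge 1"
  shows "mfps_compose f u - (\<Sum>s | mdeg s \<le> d. mfps_const (mfps_nth f s) * monom_subst u s) \<in> ord_ge (Suc d)"
proof (rule ord_geI)
  fix m :: "nat ^ 'w" assume "mdeg m < Suc d"
  then have "mfps_nth (mfps_compose f u) m
      = (\<Sum>s | mdeg s \<le> d. mfps_nth f s * mfps_nth (monom_subst u s) m)"
    using assms unfolding ord_ge_1_iff by (intro mfps_nth_compose) auto
  then show "mfps_nth (mfps_compose f u - (\<Sum>s | mdeg s \<le> d. mfps_const (mfps_nth f s) * monom_subst u s)) m = 0"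
    by simp
qed

lemma mfps_compose_add: "mfps_compose (f + g) u = mfps_compose f u + mfps_compose g u"
  and mfps_compose_diff: "mfps_compose (f - g) u = mfps_compose f u - mfps_compose g u"
  and mfps_compose_uminus: "mfps_compose (- f) u = - mfps_compose f u"
  by (rule mfps_eqI; simp add: mfps_compose_def algebra_simps sum.distrib sum_subtractf sum_negf)+

lemma mfps_compose_const_mult: "mfps_compose (mfps_const c * f) u = mfps_const c * mfps_compose f u"
  by (rule mfps_eqI) (simp add: mfps_compose_def sum_distrib_left mult.assoc)

lemma mfps_compose_const [simp]: "mfps_compose (mfps_const c) u = mfps_const c"
proof (rule mfps_eqI)
  fix m
  have "mfps_nth (mfps_compose (mfps_const c) u) m
      = (\<Sum>s | mdeg s \<le> mdeg m. if s = 0 then c * mfps_nth (monom_subst u s) m else 0)"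
    unfolding mfps_compose_def mfps_nth_Abs by (rule sum.cong) (auto simp: mfps_nth_const)
  then show "mfps_nth (mfps_compose (mfps_const c) u) m = mfps_nth (mfps_const c) m"
    by (simp add: mfps_nth_const mfps_nth_one)
qed

lemma mfps_nth_compose_0: "mfps_nth (mfps_compose f u) 0 = mfps_nth f 0"
  by (simp add: mfps_compose_def mfps_nth_one)

lemma mfps_compose_ord_ge:
  assumes "\<And>v. u v \<in> ord_ge 1" "f \<in> ord_ge d"
  shows "mfps_compose f u \<in> ord_ge d"
  by (rule ord_geI) (auto simp: mfps_compose_def ord_geD[OF assms(2)] intro!: sum.neutral)

lemma monom_subst_axis: "monom_subst u (axis j 1) = u j"
proof -
  have "monom_subst u (axis j 1) = (\<Prod>v\<in>UNIV. if v = j then u j else 1)"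
    by (rule prod.cong) (auto simp: axis_def)
  then show ?thesis by simp
qed

lemma mfps_compose_X:
  assumes "\<And>v. u v \<in> ord_ge 1"
  shows "mfps_compose (mfps_X j) u = u j"
proof (rule eq_if_diff_ord_ge)
  fix d
  have "(\<Sum>s | mdeg s \<le> Suc d. mfps_const (mfps_nth (mfps_X j) s) * monom_subst u s)
      = (\<Sum>s\<in>{axis j 1}. monom_subst u s)"
    by (rule sum.mono_neutral_cong_right) (auto simp: mfps_X_def monom_subst_axis[simplified])
  then have "mfps_compose (mfps_X j) u - u j \<in> ord_ge (Suc (Suc d))"
    using mfps_compose_approx[of u "mfps_X j" "Suc d"] assms by (simp add: monom_subst_axis[simplified])
  then show "mfps_compose (mfps_X j) u - u j \<in> ord_ge d" by (rule ord_ge_mono) simp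
qed

text \<open>Factoring \<open>f - g\<close> out of \<open>f\<^sup>k - g\<^sup>k\<close> leaves \<open>k - 1\<close> factors of positive order.\<close>
lemma power_diff_ord_ge:
  assumes "f \<in> ord_ge 1" "g \<in> ord_ge 1" "f - g \<in> ord_ge d"
  shows "f ^ k - g ^ k \<in> ord_ge (d + (k - 1))"
proof (induction k)
  case (Suc k)
  have "f ^ k \<in> ord_ge k"
    using assms(1) unfolding ord_ge_1_iff by (intro ord_geI mfps_nth_power_eq_0)
  moreover have "g * (f ^ k - g ^ k) \<in> ord_ge (d + k)"
  proof (cases k)
    case (Suc l)
    with ord_ge_mult[OF assms(2) Suc.IH] show ?thesis by simp
  qed simp
  moreover have "f ^ Suc k - g ^ Suc k = (f - g) * f ^ k + g * (f ^ k - g ^ k)"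
    by (simp add: algebra_simps)
  ultimately show ?case using ord_ge_mult[OF assms(3), of "f ^ k" k] by (auto intro: ord_ge_add)
qed simp

lemma monom_subst_diff_ord_ge:
  fixes u :: "'v :: finite \<Rightarrow> ('a :: comm_ring_1, 'w :: finite) mfps"
  assumes u: "\<And>v. u v \<in> ord_ge 1" and w: "\<And>v. w v \<in> ord_ge 1" and d: "\<And>v. u v - w v \<in> ord_ge d"
  shows "monom_subst u s - monom_subst w s \<in> ord_ge (d + (mdeg s - 1))"
proof -
  have pw: "h ^ k \<in> ord_ge k" if "h \<in> ord_ge 1" for h :: "('a, 'w) mfps" and k
    using that unfolding ord_ge_1_iff by (intro ord_geI mfps_nth_power_eq_0)
  have P: "(\<Prod>v\<in>V. h v ^ (s $ v)) \<in> ord_ge (\<Sum>v\<in>V. s $ v)" if "finite V" "\<And>v. h v \<in> ord_ge 1"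
    for h :: "'v \<Rightarrow> ('a, 'w) mfps" and V
    using that(1) by (induction V rule: finite_induct) (auto intro!: ord_ge_mult pw that(2)[simplified])
  have "(\<Prod>v\<in>V. u v ^ (s $ v)) - (\<Prod>v\<in>V. w v ^ (s $ v)) \<in> ord_ge (d + ((\<Sum>v\<in>V. s $ v) - 1))"
    if "finite V" for V
    using that
  proof (induction V rule: finite_induct)
    case (insert v V)
    let ?U = "\<Prod>v\<in>V. u v ^ (s $ v)" and ?W = "\<Prod>v\<in>V. w v ^ (s $ v)" and ?k = "s $ v"
      and ?K = "\<Sum>v\<in>V. s $ v"
    have 1: "(u v ^ ?k - w v ^ ?k) * ?U \<in> ord_ge (d + (?k + ?K - 1))"
    proof (cases "?k = 0")
      case False
      have "(u v ^ ?k - w v ^ ?k) * ?U \<in> ord_ge (d + (?k - 1) + ?K)"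
        by (intro ord_ge_mult power_diff_ord_ge u w d P insert)
      with False show ?thesis by (auto elim: ord_ge_mono)
    qed simp
    have 2: "w v ^ ?k * (?U - ?W) \<in> ord_ge (d + (?k + ?K - 1))"
    proof (cases "?K = 0")
      case True
      then show ?thesis using insert by simp
    next
      case False
      have "w v ^ ?k * (?U - ?W) \<in> ord_ge (?k + (d + (?K - 1)))"
        by (intro ord_ge_mult pw w insert)
      with False show ?thesis by (auto elim: ord_ge_mono)
    qed
    have "u v ^ ?k * ?U - w v ^ ?k * ?W = (u v ^ ?k - w v ^ ?k) * ?U + w v ^ ?k * (?U - ?W)"
      by (simp add: algebra_simps)
    with ord_ge_add[OF 1 2] insert show ?case by simp
  qed simp
  from this[of UNIV] show ?thesis by (simp add: mdeg_def)
qed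

text \<open>A change of order \<open>d\<close> in the arguments changes a series of order \<open>r\<close> by terms of order
  \<open>d + r - 1\<close>, as in the mean value theorem with a derivative of order \<open>r - 1\<close>. This gain over \<open>d\<close>
  is what makes the linearisation work.\<close>
lemma mfps_compose_diff_ord_ge:
  fixes u :: "'v :: finite \<Rightarrow> ('a :: comm_ring_1, 'w :: finite) mfps"
  assumes u: "\<And>v. u v \<in> ord_ge 1" and w: "\<And>v. w v \<in> ord_ge 1" and d: "\<And>v. u v - w v \<in> ord_ge d"
    and f: "f \<in> ord_ge r"
  shows "mfps_compose f u - mfps_compose f w \<in> ord_ge (d + (r - 1))"
proof (rule ord_geI)
  fix m :: "nat ^ 'w" assume m: "mdeg m < d + (r - 1)"
  have "mfps_nth f s * (mfps_nth (monom_subst u s) m - mfps_nth (monom_subst w s) m) = 0" for s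
  proof (cases "mdeg s < r")
    case True
    then show ?thesis using f by (simp add: ord_geD)
  next
    case False
    then have "mdeg m < d + (mdeg s - 1)" using m by auto
    then have "mfps_nth (monom_subst u s) m = mfps_nth (monom_subst w s) m"
      by (rule ord_ge_diffD[rotated]) (intro monom_subst_diff_ord_ge u w d)
    then show ?thesis by simp
  qed
  then show "mfps_nth (mfps_compose f u - mfps_compose f w) m = 0"
    by (simp add: mfps_compose_def sum_subtractf[symmetric] right_diff_distrib[symmetric])
qed

lemma monom_subst_deriv:
  "mfps_deriv v (monom_subst u s) =
     (\<Sum>j\<in>UNIV. of_nat (s $ j) * monom_subst u (s - axis j 1) * mfps_deriv v (u j))"
proof -
  have "mfps_deriv v (u j ^ (s $ j)) * (\<Prod>i\<in>UNIV - {j}. u i ^ (s $ i))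
      = of_nat (s $ j) * monom_subst u (s - axis j 1) * mfps_deriv v (u j)" for j
  proof -
    have "monom_subst u (s - axis j 1)
        = u j ^ (s $ j - 1) * (\<Prod>i\<in>UNIV - {j}. u i ^ ((s - axis j 1) $ i))"
      by (subst prod.remove[of _ j]) (auto simp: axis_def)
    also have "(\<Prod>i\<in>UNIV - {j}. u i ^ ((s - axis j 1) $ i)) = (\<Prod>i\<in>UNIV - {j}. u i ^ (s $ i))"
      by (rule prod.cong) (auto simp: axis_def)
    finally show ?thesis by (simp add: mfps_deriv_power mult_ac)
  qed
  then show ?thesis by (simp add: mfps_deriv_prod)
qed

text \<open>The chain rule: both sides are approximated by the polynomial expressions of lemma
  \<open>mfps_compose_approx\<close>. The derivative lowers degrees by one, hence the approximation of \<open>f\<close> up to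
  degree \<open>d + 1\<close>.\<close>
lemma mfps_deriv_compose:
  assumes u: "\<And>v. u v \<in> ord_ge 1"
  shows "mfps_deriv v (mfps_compose f u) = (\<Sum>j\<in>UNIV. mfps_compose (mfps_deriv j f) u * mfps_deriv v (u j))"
proof (rule eq_if_diff_ord_ge)
  fix d
  let ?p = "\<lambda>g d. \<Sum>s | mdeg s \<le> d. mfps_const (mfps_nth g s) * monom_subst u s"
  have shift: "(\<Sum>s | mdeg s \<le> Suc d. mfps_const (mfps_nth f s) * (of_nat (s $ j) * monom_subst u (s - axis j 1)))
      = ?p (mfps_deriv j f) d" for j
  proof -
    have "(\<Sum>s | mdeg s \<le> Suc d. mfps_const (mfps_nth f s) * (of_nat (s $ j) * monom_subst u (s - axis j 1)))
        = (\<Sum>s | mdeg s \<le> Suc d \<and> s $ j > 0. mfps_const (mfps_nth f s) * (of_nat (s $ j) * monom_subst u (s - axis j 1)))"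
      by (rule sum.mono_neutral_right[OF finite_mdeg_le]) (auto intro: gr0I)
    also have "\<dots> = ?p (mfps_deriv j f) d"
      by (rule sum.reindex_bij_witness[of _ "\<lambda>s. s + axis j 1" "\<lambda>s. s - axis j 1"])
        (auto dest!: eq_add_axis_if_pos simp: mfps_nth_deriv mfps_const_mult mfps_const_add mfps_const_of_nat mult_ac)
    finally show ?thesis .
  qed
  have A: "mfps_deriv v (mfps_compose f u) - mfps_deriv v (?p f (Suc d)) \<in> ord_ge (Suc d)"
    unfolding mfps_deriv_diff[symmetric] by (intro ord_ge_deriv mfps_compose_approx u)
  have "mfps_deriv v (?p f (Suc d)) = (\<Sum>s | mdeg s \<le> Suc d. \<Sum>j\<in>UNIV.
      mfps_const (mfps_nth f s) * (of_nat (s $ j) * monom_subst u (s - axis j 1)) * mfps_deriv v (u j))"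
    unfolding mfps_deriv_sum mfps_deriv_const_mult monom_subst_deriv sum_distrib_left
    by (simp add: mult_ac)
  also have "\<dots> = (\<Sum>j\<in>UNIV. ?p (mfps_deriv j f) d * mfps_deriv v (u j))"
    unfolding sum.swap[of _ _ "{s. mdeg s \<le> Suc d}"] sum_distrib_right[symmetric] shift ..
  finally have B: "mfps_deriv v (?p f (Suc d)) = (\<Sum>j\<in>UNIV. ?p (mfps_deriv j f) d * mfps_deriv v (u j))" .
  have C: "(\<Sum>j\<in>UNIV. ?p (mfps_deriv j f) d * mfps_deriv v (u j))
      - (\<Sum>j\<in>UNIV. mfps_compose (mfps_deriv j f) u * mfps_deriv v (u j)) \<in> ord_ge (Suc d)"
    unfolding sum_subtractf[symmetric] left_diff_distrib[symmetric]
    by (intro ord_ge_sum ord_ge_mult_left) (intro ord_ge_diff_commute[OF mfps_compose_approx] u)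
  have "mfps_deriv v (mfps_compose f u)
      - (\<Sum>j\<in>UNIV. mfps_compose (mfps_deriv j f) u * mfps_deriv v (u j)) \<in> ord_ge (Suc d)"
    using A C unfolding B by (rule ord_ge_trans)
  then show "mfps_deriv v (mfps_compose f u)
      - (\<Sum>j\<in>UNIV. mfps_compose (mfps_deriv j f) u * mfps_deriv v (u j)) \<in> ord_ge d"
    by (rule ord_ge_mono) simp
qed

section \<open>Endomorphisms commuting with composition\<close>

definition mfps_map :: "('a \<Rightarrow> 'a) \<Rightarrow> ('a :: comm_ring_1, 'v :: finite) mfps \<Rightarrow> ('a, 'v) mfps" where
  "mfps_map \<sigma> f = Abs_mfps (\<lambda>m. \<sigma> (mfps_nth f m))"

text \<open>Ring endomorphisms which do not lower the order and act on constants by \<open>\<sigma>\<close>. Rotations, the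
  reflection of all variables and complex conjugation are of this kind, and all that is needed of
  them is that they commute with composition, inverses and square roots.\<close>
locale series_hom =
  fixes T :: "(complex, 'w :: finite) mfps \<Rightarrow> (complex, 'w) mfps" and \<sigma> :: "complex \<Rightarrow> complex"
  assumes add: "T (f + g) = T f + T g"
    and mult: "T (f * g) = T f * T g"
    and const: "T (mfps_const c) = mfps_const (\<sigma> c)"
    and ord: "f \<in> ord_ge d \<Longrightarrow> T f \<in> ord_ge d"
    and \<sigma>_1: "\<sigma> 1 = 1"
begin

lemma one: "T 1 = 1"
  using const[of 1] by (simp add: \<sigma>_1)

lemma zero: "T 0 = 0"
  using add[of 0 0] by simp

lemma uminus: "T (- f) = - T f"
  using add[of f "- f"] by (simp add: zero eq_neg_iff_add_eq_0 add.commute)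

lemma diff: "T (f - g) = T f - T g"
  using add[of f "- g"] by (simp add: uminus)

lemma sum: "T (sum f A) = (\<Sum>i\<in>A. T (f i))"
  by (induction A rule: infinite_finite_induct) (auto simp: add zero)

lemma prod: "T (prod f A) = (\<Prod>i\<in>A. T (f i))"
  by (induction A rule: infinite_finite_induct) (auto simp: mult one)

lemma power: "T (f ^ k) = T f ^ k"
  by (induction k) (auto simp: mult one)

lemma nth_0: "mfps_nth (T f) 0 = \<sigma> (mfps_nth f 0)"
proof -
  have "T f - mfps_const (\<sigma> (mfps_nth f 0)) \<in> ord_ge 1"
    unfolding const[symmetric] diff[symmetric] by (intro ord ord_ge_minus_const)
  from ord_ge_diffD[OF this, of 0] show ?thesis by (simp add: mfps_nth_const)
qed

lemma compose:
  assumes u: "\<And>v. u v \<in> ord_ge 1"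
  shows "T (mfps_compose f u) = mfps_compose (mfps_map \<sigma> f) (\<lambda>v. T (u v))"
proof (rule eq_if_diff_ord_ge)
  fix d
  have "T (mfps_compose f u) - T (\<Sum>s | mdeg s \<le> d. mfps_const (mfps_nth f s) * monom_subst u s) \<in> ord_ge (Suc d)"
    unfolding diff[symmetric] by (intro ord mfps_compose_approx u)
  moreover have "T (\<Sum>s | mdeg s \<le> d. mfps_const (mfps_nth f s) * monom_subst u s)
      = (\<Sum>s | mdeg s \<le> d. mfps_const (mfps_nth (mfps_map \<sigma> f) s) * monom_subst (\<lambda>v. T (u v)) s)"
    by (simp add: sum mult const prod power mfps_map_def)
  ultimately have "T (mfps_compose f u) - mfps_compose (mfps_map \<sigma> f) (\<lambda>v. T (u v)) \<in> ord_ge (Suc d)"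
    using ord_ge_trans ord_ge_diff_commute[OF mfps_compose_approx[of "\<lambda>v. T (u v)" "mfps_map \<sigma> f" d, OF ord, OF u]]
    by simp
  then show "T (mfps_compose f u) - mfps_compose (mfps_map \<sigma> f) (\<lambda>v. T (u v)) \<in> ord_ge d"
    by (rule ord_ge_mono) simp
qed

lemma inverse:
  assumes "mfps_nth f 0 \<noteq> 0" shows "T (inverse f) = inverse (T f)"
  using mfps_inverse_unique[of "T f" "T (inverse f)"] mfps_right_inverse[OF assms]
  by (simp add: mult[symmetric] one)

lemma sqrt:
  assumes "mfps_nth f 0 \<noteq> 0" "\<sigma> (mfps_nth f 0) \<noteq> 0"
    and "\<sigma> (csqrt (mfps_nth f 0)) = csqrt (\<sigma> (mfps_nth f 0))"
  shows "T (mfps_sqrt f) = mfps_sqrt (T f)"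
  using mfps_sqrt[OF assms(1)] assms
  by (intro mfps_sqrt_unique[symmetric]) (simp_all add: power[symmetric] nth_0)

end

lemma mfps_nth_scale: "mfps_nth (mfps_scale c f) m = (\<Prod>v\<in>UNIV. c v ^ (m $ v)) * mfps_nth f m"
  by (simp add: mfps_scale_def)

lemma mfps_map_id [simp]: "mfps_map id f = f" "mfps_map (\<lambda>x. x) f = f"
  by (rule mfps_eqI; simp add: mfps_map_def)+

interpretation scale: series_hom "mfps_scale c" "\<lambda>x. x" for c :: "'w :: finite \<Rightarrow> complex"
proof
  fix f g :: "(complex, 'w) mfps"
  show "mfps_scale c (f + g) = mfps_scale c f + mfps_scale c g"
    by (rule mfps_eqI) (simp add: mfps_nth_scale algebra_simps)
  show "mfps_scale c (f * g) = mfps_scale c f * mfps_scale c g"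
  proof (rule mfps_eqI)
    fix m :: "nat ^ 'w"
    have *: "(\<Prod>v\<in>UNIV. c v ^ (m $ v)) = (\<Prod>v\<in>UNIV. c v ^ (a $ v)) * (\<Prod>v\<in>UNIV. c v ^ (b $ v))"
      if "a + b = m" for a b :: "nat ^ 'w"
      using that by (auto simp: power_add prod.distrib)
    show "mfps_nth (mfps_scale c (f * g)) m = mfps_nth (mfps_scale c f * mfps_scale c g) m"
      unfolding mfps_nth_scale mfps_nth_mult sum_distrib_left
    proof (rule sum.cong, simp, clarify)
      fix a b :: "nat ^ 'w" assume "m = a + b"
      from *[OF this[symmetric]]
      show "(\<Prod>v\<in>UNIV. c v ^ ((a + b) $ v)) * (mfps_nth f a * mfps_nth g b)
          = (\<Prod>v\<in>UNIV. c v ^ (a $ v)) * mfps_nth f a * ((\<Prod>v\<in>UNIV. c v ^ (b $ v)) * mfps_nth g b)"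
        by (simp only: \<open>m = a + b\<close> mult.assoc mult.left_commute)
    qed
  qed
next
  fix x show "mfps_scale c (mfps_const x) = mfps_const x"
    by (rule mfps_eqI) (simp add: mfps_nth_scale mfps_nth_const)
qed (auto simp: ord_ge_def mfps_nth_scale)

text \<open>With \<open>c\<close> the factors by which an endomorphism scales the variables, this compares its
  effect on a monomial and on the monomial times one more variable.\<close>
lemma prod_power_add_axis:
  "(\<Prod>w\<in>UNIV. c w ^ ((m + axis v 1) $ w)) = c v * (\<Prod>w\<in>UNIV. c w ^ (m $ w))"
  for c :: "'v :: finite \<Rightarrow> 'a :: comm_monoid_mult"
  by (subst (1 2) prod.remove[of _ v]) (auto simp: axis_def mult_ac intro!: prod.cong)

lemma mfps_deriv_scale: "mfps_deriv v (mfps_scale c f) = mfps_const (c v) * mfps_scale c (mfps_deriv v f)"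
  by (rule mfps_eqI)
    (simp add: mfps_nth_deriv mfps_nth_scale prod_power_add_axis algebra_simps del: vector_add_component One_nat_def)

lemma mfps_compose_scaled:
  fixes u :: "'v :: finite \<Rightarrow> ('a :: comm_ring_1, 'w :: finite) mfps"
  shows "mfps_compose f (\<lambda>v. mfps_const (c v) * u v) = mfps_compose (mfps_scale c f) u"
proof (rule mfps_eqI)
  fix m :: "nat ^ 'w"
  have "monom_subst (\<lambda>v. mfps_const (c v) * u v) s = mfps_const (\<Prod>v\<in>UNIV. c v ^ (s $ v)) * monom_subst u s" for s
  proof -
    have "mfps_const (\<Prod>v\<in>A. c v ^ (s $ v)) = (\<Prod>v\<in>A. mfps_const (c v) ^ (s $ v) :: ('a, 'w) mfps)" for A
      by (induction A rule: infinite_finite_induct) (auto simp: mfps_const_mult mfps_const_power)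
    then show ?thesis by (simp add: power_mult_distrib prod.distrib)
  qed
  then show "mfps_nth (mfps_compose f (\<lambda>v. mfps_const (c v) * u v)) m = mfps_nth (mfps_compose (mfps_scale c f) u) m"
    by (simp add: mfps_compose_def mfps_nth_scale mult.left_commute mult.assoc)
qed

text \<open>The unit vectors \<open>axis v 1\<close> and the orders \<open>ord_ge 1\<close> occur in many assumptions, which have to
  match goals in this form also after simplification.\<close>
declare One_nat_def [simp del]

section \<open>Averaging and balanced monomials\<close>

text \<open>The exponents of the monomials invariant under the torus action.\<close>
definition balanced :: "nat ^ ('n :: finite + 'n) \<Rightarrow> bool" where
  "balanced m \<longleftrightarrow> (\<exists>k. m = zexp k k)"

lemma zexp_nth [simp]: "zexp k k' $ Inl j = k $ j" "zexp k k' $ Inr j = k' $ j"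
  by (simp_all add: zexp_def)

lemma vec_sum_eq_iff: "m = m' \<longleftrightarrow> (\<forall>j. m $ Inl j = m' $ Inl j) \<and> (\<forall>j. m $ Inr j = m' $ Inr j)"
  by (auto simp: vec_eq_iff split_sum_all)

lemma balanced_iff: "balanced m \<longleftrightarrow> (\<forall>j. m $ Inl j = m $ Inr j)"
proof
  assume *: "\<forall>j. m $ Inl j = m $ Inr j"
  show "balanced m" unfolding balanced_def
    by (rule exI[of _ "\<chi> j. m $ Inl j"]) (use * in \<open>simp add: vec_sum_eq_iff\<close>)
qed (auto simp: balanced_def)

lemma UNIV_sum_prod: "(\<Prod>v\<in>UNIV. g v) = (\<Prod>j\<in>UNIV. g (Inl j)) * (\<Prod>j\<in>UNIV. g (Inr j))"
  for g :: "'n :: finite + 'n \<Rightarrow> 'c :: comm_monoid_mult"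
  by (simp add: UNIV_Plus_UNIV[symmetric] prod.Plus del: UNIV_Plus_UNIV)

lemma mdeg_zexp: "mdeg (zexp k k') = mdeg k + mdeg k'" for k :: "nat ^ ('n :: finite)"
  by (simp add: mdeg_def UNIV_Plus_UNIV[symmetric] sum.Plus del: UNIV_Plus_UNIV)

lemma mfps_nth_avg: "mfps_nth (avg g) m = (if balanced m then mfps_nth g m else 0)"
  by (simp add: avg_def balanced_def)

text \<open>The two cases in the definition of the average of a form say the same: the coefficient
  monomial times the variable under the differential is balanced.\<close>
lemma mfps_nth_form_avg:
  "mfps_nth (form_avg \<omega> v) m = (if balanced (m + axis v 1) then mfps_nth (\<omega> v) m else 0)"
proof (cases v)
  case (Inl j)
  have "(\<exists>k k'. m = zexp k k' \<and> k + axis j 1 = k') \<longleftrightarrow> balanced (m + axis v 1)"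
    unfolding balanced_iff
  proof
    assume *: "\<forall>i. (m + axis v 1) $ Inl i = (m + axis v 1) $ Inr i"
    show "\<exists>k k'. m = zexp k k' \<and> k + axis j 1 = k'"
      by (rule exI[of _ "\<chi> i. m $ Inl i"], rule exI[of _ "\<chi> i. m $ Inr i"])
        (use * in \<open>auto simp: vec_sum_eq_iff vec_eq_iff Inl axis_def\<close>)
  qed (auto simp: Inl axis_def)
  then show ?thesis by (simp add: form_avg_def Inl)
next
  case (Inr j)
  have "(\<exists>k k'. m = zexp k k' \<and> k = k' + axis j 1) \<longleftrightarrow> balanced (m + axis v 1)"
    unfolding balanced_iff
  proof
    assume *: "\<forall>i. (m + axis v 1) $ Inl i = (m + axis v 1) $ Inr i"
    show "\<exists>k k'. m = zexp k k' \<and> k = k' + axis j 1"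
      by (rule exI[of _ "\<chi> i. m $ Inl i"], rule exI[of _ "\<chi> i. m $ Inr i"])
        (use * in \<open>auto simp: vec_sum_eq_iff vec_eq_iff Inr axis_def\<close>)
  qed (auto simp: Inr axis_def)
  then show ?thesis by (simp add: form_avg_def Inr)
qed

section \<open>Complex conjugation\<close>

definition zswap :: "nat ^ ('n :: finite + 'n) \<Rightarrow> nat ^ ('n + 'n)" where
  "zswap m = (\<chi> v. case v of Inl j \<Rightarrow> m $ Inr j | Inr j \<Rightarrow> m $ Inl j)"

lemma zswap_nth [simp]: "zswap m $ Inl j = m $ Inr j" "zswap m $ Inr j = m $ Inl j"
  by (simp_all add: zswap_def)

lemma zswap_zswap [simp]: "zswap (zswap m) = m"
  and zswap_add: "zswap (m + m') = zswap m + zswap m'"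
  and zswap_zexp [simp]: "zswap (zexp k k') = zexp k' k"
  and zswap_balanced: "balanced m \<Longrightarrow> zswap m = m"
  by (auto simp: vec_sum_eq_iff balanced_iff)

lemma mdeg_zswap [simp]: "mdeg (zswap m) = mdeg m" for m :: "nat ^ ('n :: finite + 'n)"
  by (simp add: mdeg_def UNIV_Plus_UNIV[symmetric] sum.Plus add.commute del: UNIV_Plus_UNIV)

lemma zswap_eq_0_iff [simp]: "zswap m = 0 \<longleftrightarrow> m = 0" for m :: "nat ^ ('n :: finite + 'n)"
  by (metis mdeg_zswap mdeg_eq_0_iff)

definition zconj :: "('n :: finite) zseries \<Rightarrow> 'n zseries" where
  "zconj g = Abs_mfps (\<lambda>m. cnj (mfps_nth g (zswap m)))"

lemma mfps_nth_zconj: "mfps_nth (zconj g) m = cnj (mfps_nth g (zswap m))"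
  by (simp add: zconj_def)

interpretation zconj: series_hom "zconj :: ('n :: finite) zseries \<Rightarrow> 'n zseries" cnj
proof
  fix f g :: "'n zseries"
  show "zconj (f + g) = zconj f + zconj g"
    by (rule mfps_eqI) (simp add: mfps_nth_zconj)
  show "zconj (f * g) = zconj f * zconj g"
  proof (rule mfps_eqI)
    fix m
    have "(\<Sum>(a, b) | a + b = zswap m. cnj (mfps_nth f a) * cnj (mfps_nth g b))
        = (\<Sum>(a, b) | a + b = m. cnj (mfps_nth f (zswap a)) * cnj (mfps_nth g (zswap b)))"
      by (rule sum.reindex_bij_witness[of _ "\<lambda>(a, b). (zswap a, zswap b)" "\<lambda>(a, b). (zswap a, zswap b)"])
        (auto simp flip: zswap_add)
    then show "mfps_nth (zconj (f * g)) m = mfps_nth (zconj f * zconj g) m"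
      by (simp add: mfps_nth_zconj mfps_nth_mult case_prod_unfold)
  qed
next
  fix c show "zconj (mfps_const c) = mfps_const (cnj c)"
    by (rule mfps_eqI) (simp add: mfps_nth_zconj mfps_nth_const)
qed (auto simp: ord_ge_def mfps_nth_zconj)

section \<open>Rotation\<close>

text \<open>The factor by which the rotation multiplies the monomial with exponent \<open>m\<close>.\<close>
definition multiplier :: "complex ^ 'n \<Rightarrow> nat ^ ('n :: finite + 'n) \<Rightarrow> complex" where
  "multiplier lam m = (\<Prod>j\<in>UNIV. lam $ j ^ (m $ Inl j)) * (\<Prod>j\<in>UNIV. inverse (lam $ j) ^ (m $ Inr j))"

lemma mfps_nth_rot: "mfps_nth (rot lam g) m = multiplier lam m * mfps_nth g m"
  by (simp add: rot_def mfps_nth_scale UNIV_sum_prod multiplier_def)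

lemma multiplier_inv_rot: "multiplier (inv_rot lam) m = inverse (multiplier lam m)"
  by (simp add: multiplier_def inv_rot_def prod_inversef[symmetric] power_inverse[symmetric] mult.commute)

lemma multiplier_nonzero: "(\<And>j. lam $ j \<noteq> 0) \<Longrightarrow> multiplier lam m \<noteq> 0"
  by (simp add: multiplier_def)

lemma rot_rot_inv: "(\<And>j. lam $ j \<noteq> 0) \<Longrightarrow> rot lam (rot (inv_rot lam) g) = g"
  by (rule mfps_eqI) (simp add: mfps_nth_rot multiplier_inv_rot multiplier_nonzero)

lemma cnj_eq_inverse: "norm z = 1 \<Longrightarrow> cnj z = inverse z" for z :: complex
  using complex_norm_square[of z] inverse_unique[of z "cnj z"] by simp

lemma multiplier_cnj:
  assumes "\<And>j. norm (lam $ j) = 1"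
  shows "cnj (multiplier lam m) = multiplier lam (zswap m)"
  by (simp add: multiplier_def cnj_eq_inverse assms mult.commute)

lemma zconj_rot:
  assumes "\<And>j. norm (lam $ j) = 1"
  shows "zconj (rot lam g) = rot lam (zconj g)"
  by (rule mfps_eqI) (simp add: mfps_nth_zconj mfps_nth_rot multiplier_cnj[OF assms])

lemma rot_ord_ge: "g \<in> ord_ge d \<Longrightarrow> rot lam g \<in> ord_ge d"
  unfolding rot_def by (rule scale.ord)

lemma rot_diff: "rot lam (f - g) = rot lam f - rot lam g"
  unfolding rot_def by (rule scale.diff)

lemma rot_uminus: "rot lam (- g) = - rot lam g"
  unfolding rot_def by (rule scale.uminus)

lemma rot_compose:
  "(\<And>v. u v \<in> ord_ge 1) \<Longrightarrow> rot lam (mfps_compose f u) = mfps_compose f (\<lambda>v. rot lam (u v))"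
  unfolding rot_def by (subst scale.compose) simp_all

section \<open>The Lagrangian and the Euler-Lagrange series\<close>

lemma mfps_deriv_power2: "mfps_deriv v (g\<^sup>2) = 2 * (g * mfps_deriv v g)"
  by (simp add: mfps_deriv_power mult.assoc)

definition lagrangian_sq ::
    "(complex, 'n :: finite) mfps \<Rightarrow> ('n \<Rightarrow> 'n zseries) \<Rightarrow> ('n \<Rightarrow> 'n zseries) \<Rightarrow> 'n zseries" where
  "lagrangian_sq f x y = (\<Sum>j\<in>UNIV. (x j - y j) ^ 2) + (mfps_compose f x + mfps_compose f y) ^ 2"

lemma lagrangian_eq: "lagrangian f x y = mfps_sqrt (lagrangian_sq f x y)"
  by (simp add: lagrangian_def lagrangian_sq_def)

lemma lagrangian_commute: "lagrangian f x y = lagrangian f y x"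
  by (simp add: lagrangian_def power2_commute add.commute)

lemma nth_lagrangian_sq_0:
  assumes "\<And>v. x v \<in> ord_ge 1" "\<And>v. y v \<in> ord_ge 1"
  shows "mfps_nth (lagrangian_sq f x y) 0 = 4 * (mfps_nth f 0)\<^sup>2"
  using assms unfolding ord_ge_1_iff
  by (simp add: lagrangian_sq_def mfps_nth_compose_0 power2_eq_square)

lemma nth_lagrangian_0:
  assumes "\<And>v. x v \<in> ord_ge 1" "\<And>v. y v \<in> ord_ge 1" "mfps_nth f 0 \<noteq> 0"
  shows "mfps_nth (lagrangian f x y) 0 = csqrt (4 * (mfps_nth f 0)\<^sup>2)"
  using mfps_sqrt(2)[of "lagrangian_sq f x y"] assms by (simp add: lagrangian_eq nth_lagrangian_sq_0)

text \<open>The partial derivative of the Lagrangian with respect to the component \<open>y\<^sub>j\<close> of its second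
  argument. By symmetry of the Lagrangian, exchanging \<open>x\<close> and \<open>y\<close> gives the derivative with respect
  to \<open>x\<^sub>j\<close>.\<close>
definition lagrangian_dy where
  "lagrangian_dy f x y j =
     (y j - x j + (mfps_compose f x + mfps_compose f y) * mfps_compose (mfps_deriv j f) y) / lagrangian f x y"

text \<open>Differentiating \<open>L\<^sup>2\<close> avoids derivatives of the square root; the factor \<open>2 L\<close> cancels at the
  end.\<close>
lemma deriv_lagrangian:
  assumes x: "\<And>v. x v \<in> ord_ge 1" and y: "\<And>v. y v \<in> ord_ge 1" and f0: "mfps_nth f 0 \<noteq> 0"
  shows "mfps_deriv v (lagrangian f x y)
    = (\<Sum>j\<in>UNIV. lagrangian_dy f x y j * mfps_deriv v (y j)) + (\<Sum>j\<in>UNIV. lagrangian_dy f y x j * mfps_deriv v (x j))"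
proof -
  let ?L = "lagrangian f x y" and ?S = "mfps_compose f x + mfps_compose f y"
  have L0: "mfps_nth ?L 0 \<noteq> 0" by (simp add: nth_lagrangian_0 x y f0)
  have P: "?L * lagrangian_dy f x y j = y j - x j + ?S * mfps_compose (mfps_deriv j f) y"
    and Q: "?L * lagrangian_dy f y x j = x j - y j + ?S * mfps_compose (mfps_deriv j f) x" for j
  proof -
    have cancel: "?L * (a * inverse ?L) = a" for a
      using mfps_right_inverse[OF L0] by (metis mult.left_commute mult_1_right)
    show "?L * lagrangian_dy f x y j = y j - x j + ?S * mfps_compose (mfps_deriv j f) y"
      unfolding lagrangian_dy_def divide_mfps_def by (rule cancel)
    show "?L * lagrangian_dy f y x j = x j - y j + ?S * mfps_compose (mfps_deriv j f) x"
      unfolding lagrangian_dy_def divide_mfps_def lagrangian_commute[of f y x] add.commute[of "mfps_compose f y"]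
      by (rule cancel)
  qed
  have "2 * ?L * mfps_deriv v ?L = mfps_deriv v (?L ^ 2)"
    by (simp add: mfps_deriv_power)
  also have "?L ^ 2 = lagrangian_sq f x y"
    unfolding lagrangian_eq by (rule mfps_sqrt) (simp add: nth_lagrangian_sq_0 x y f0)
  also have "mfps_deriv v (lagrangian_sq f x y)
      = 2 * ((\<Sum>j\<in>UNIV. (x j - y j) * (mfps_deriv v (x j) - mfps_deriv v (y j)))
        + ?S * ((\<Sum>j\<in>UNIV. mfps_compose (mfps_deriv j f) x * mfps_deriv v (x j))
           + (\<Sum>j\<in>UNIV. mfps_compose (mfps_deriv j f) y * mfps_deriv v (y j))))"
    by (simp add: lagrangian_sq_def mfps_deriv_add mfps_deriv_sum mfps_deriv_power2 mfps_deriv_diff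
        mfps_deriv_compose[OF x] mfps_deriv_compose[OF y] sum_distrib_left[symmetric] distrib_left[symmetric]
        del: distrib_left_numeral right_diff_distrib_numeral)
  also have "\<dots> = 2 * ((\<Sum>j\<in>UNIV. ?L * lagrangian_dy f x y j * mfps_deriv v (y j))
      + (\<Sum>j\<in>UNIV. ?L * lagrangian_dy f y x j * mfps_deriv v (x j)))"
    unfolding P Q sum_distrib_left sum.distrib[symmetric]
    by (intro arg_cong[where f = "(*) 2"] sum.cong refl) (simp add: algebra_simps)
  also have "\<dots> = 2 * ?L * ((\<Sum>j\<in>UNIV. lagrangian_dy f x y j * mfps_deriv v (y j))
      + (\<Sum>j\<in>UNIV. lagrangian_dy f y x j * mfps_deriv v (x j)))"
    by (simp add: sum_distrib_left distrib_left mult.assoc)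
  finally show ?thesis
    by (rule mfps_mult_left_cancel[rotated]) (use L0 in \<open>simp flip: mfps_const_numeral add: mfps_nth_const\<close>)
qed

text \<open>An endomorphism moves inside the Lagrangian if \<open>\<sigma>\<close> fixes the coefficients of \<open>f\<close> and the
  square root chosen for the constant term of \<open>L\<^sup>2\<close>. The second condition excludes that the
  endomorphism exchanges the two branches of the square root.\<close>
lemma series_hom_lagrangian:
  fixes x y :: "'n :: finite \<Rightarrow> 'n zseries"
  assumes T: "series_hom T \<sigma>"
    and x: "\<And>v. x v \<in> ord_ge 1" and y: "\<And>v. y v \<in> ord_ge 1" and f0: "mfps_nth f 0 \<noteq> 0"
    and f: "mfps_map \<sigma> f = f"
    and r: "\<sigma> (csqrt (4 * (mfps_nth f 0)\<^sup>2)) = csqrt (4 * (mfps_nth f 0)\<^sup>2)"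
  shows "T (lagrangian f x y) = lagrangian f (\<lambda>v. T (x v)) (\<lambda>v. T (y v))"
    and "T (lagrangian_dy f x y j) = lagrangian_dy f (\<lambda>v. T (x v)) (\<lambda>v. T (y v)) j"
proof -
  interpret series_hom T \<sigma> by (rule T)
  have df: "mfps_map \<sigma> (mfps_deriv j f) = mfps_deriv j f" for j
  proof (rule mfps_eqI)
    fix m
    have "mfps_const (\<sigma> (c * d)) = (mfps_const (\<sigma> c) * mfps_const (\<sigma> d) :: 'n zseries)"
      and "mfps_const (\<sigma> (c + d)) = (mfps_const (\<sigma> c) + mfps_const (\<sigma> d) :: 'n zseries)" for c d
      unfolding const[symmetric] mfps_const_mult mfps_const_add by (rule mult add)+
    then have m: "\<sigma> (c * d) = \<sigma> c * \<sigma> d" and a: "\<sigma> (c + d) = \<sigma> c + \<sigma> d" for c d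
      unfolding mfps_const_mult[symmetric] mfps_const_add[symmetric]
      by (metis mfps_nth_const)+
    have z: "\<sigma> 0 = 0" using a[of 0 0] by simp
    have "\<sigma> (of_nat n) = of_nat n" for n by (induction n) (simp_all add: a \<sigma>_1 z)
    moreover have "\<sigma> (mfps_nth f m) = mfps_nth f m" for m
      using arg_cong[OF f, of "\<lambda>g. mfps_nth g m"] by (simp add: mfps_map_def)
    ultimately show "mfps_nth (mfps_map \<sigma> (mfps_deriv j f)) m = mfps_nth (mfps_deriv j f) m"
      by (simp only: mfps_map_def mfps_nth_Abs mfps_nth_deriv m)
  qed
  have sq: "T (lagrangian_sq f x y) = lagrangian_sq f (\<lambda>v. T (x v)) (\<lambda>v. T (y v))"
    by (simp add: lagrangian_sq_def add sum power diff compose x y f)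
  have "\<sigma> (4 * (mfps_nth f 0)\<^sup>2) = 4 * (mfps_nth f 0)\<^sup>2"
    using nth_0[of "lagrangian_sq f x y"] unfolding sq by (simp add: nth_lagrangian_sq_0 x y ord)
  then show L: "T (lagrangian f x y) = lagrangian f (\<lambda>v. T (x v)) (\<lambda>v. T (y v))"
    unfolding lagrangian_eq sq[symmetric] using f0 r by (intro sqrt) (simp_all add: nth_lagrangian_sq_0 x y)
  have "mfps_nth (lagrangian f x y) 0 \<noteq> 0" using f0 by (simp add: nth_lagrangian_0 x y)
  then show "T (lagrangian_dy f x y j) = lagrangian_dy f (\<lambda>v. T (x v)) (\<lambda>v. T (y v)) j"
    by (simp add: lagrangian_dy_def divide_mfps_def mult add diff compose x y f df inverse L)
qed

lemma rot_lagrangian: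
  assumes "\<And>v. x v \<in> ord_ge 1" "\<And>v. y v \<in> ord_ge 1" "mfps_nth f 0 \<noteq> 0"
  shows "rot lam (lagrangian f x y) = lagrangian f (\<lambda>v. rot lam (x v)) (\<lambda>v. rot lam (y v))"
    and "rot lam (lagrangian_dy f x y j) = lagrangian_dy f (\<lambda>v. rot lam (x v)) (\<lambda>v. rot lam (y v)) j"
  unfolding rot_def using series_hom_lagrangian[OF scale.series_hom_axioms assms] by simp_all

text \<open>Stationarity of the action at \<open>\<chi>\<close> between its neighbours \<open>\<chi> \<circ> \<rho>\<^sup>-\<^sup>1\<close> and \<open>\<chi> \<circ> \<rho>\<close> is the
  vanishing of these series.\<close>
definition euler_lagrange where
  "euler_lagrange lam f chi j =
     lagrangian_dy f (\<lambda>i. rot (inv_rot lam) (chi i)) chi j + lagrangian_dy f (\<lambda>i. rot lam (chi i)) chi j"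

lemma billiard_form_eq:
  assumes "\<And>j. chi j \<in> ord_ge 1"
  shows "billiard_form lam f chi v = (\<Sum>j\<in>UNIV. euler_lagrange lam f chi j * mfps_deriv v (chi j))"
  by (simp add: billiard_form_def euler_lagrange_def lagrangian_dy_def tau_diff_def tau_sum_def form_d_def
      rot_compose assms lagrangian_commute[of f chi] add.commute)

lemma mfps_deriv_rot:
  "mfps_deriv v (rot lam g) = mfps_const (case v of Inl j \<Rightarrow> lam $ j | Inr j \<Rightarrow> inverse (lam $ j)) * rot lam (mfps_deriv v g)"
  unfolding rot_def by (rule mfps_deriv_scale)

text \<open>A term of a form which belongs to its average is invariant under the rotation: the factors
  from the coefficient monomial and from the differential cancel.\<close>
lemma multiplier_balanced:
  assumes "\<And>j. lam $ j \<noteq> 0" "balanced (m + axis v 1)"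
  shows "(case v of Inl j \<Rightarrow> lam $ j | Inr j \<Rightarrow> inverse (lam $ j)) * multiplier lam m = 1"
proof -
  let ?c = "\<lambda>v. case v of Inl j \<Rightarrow> lam $ j | Inr j \<Rightarrow> inverse (lam $ j)" and ?M = "m + axis v 1"
  have eq: "multiplier lam m = (\<Prod>v\<in>UNIV. ?c v ^ (m $ v))" for m
    by (simp add: multiplier_def UNIV_sum_prod)
  have "(\<Prod>w\<in>UNIV. ?c w ^ (?M $ w)) = ?c v * (\<Prod>w\<in>UNIV. ?c w ^ (m $ w))"
    by (rule prod_power_add_axis)
  then have "?c v * multiplier lam m = multiplier lam ?M" by (simp only: eq)
  also have "\<dots> = 1"
    using assms(2) unfolding balanced_iff multiplier_def
    by (simp add: prod.distrib[symmetric] power_mult_distrib[symmetric] assms(1) del: vector_add_component)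
  finally show ?thesis .
qed

text \<open>The average of the form is the differential of the averaged action. Rotating the
  part \<open>\<partial>\<^sub>x\<^sub>j L(\<chi>, \<chi>\<^sub>+) d\<chi>\<^sub>j\<close> back to \<open>\<partial>\<^sub>x\<^sub>j L(\<chi>\<^sub>-, \<chi>) d(\<chi>\<^sub>-)\<^sub>j\<close> does not change its average, and
  afterwards both parts add up to \<open>d L(\<chi>\<^sub>-, \<chi>)\<close>.\<close>
lemma billiard_form_balanced:
  assumes lam: "\<And>j. lam $ j \<noteq> 0" and chi: "\<And>j. chi j \<in> ord_ge 1" and f0: "mfps_nth f 0 \<noteq> 0"
    and m: "balanced (m + axis v 1)"
  shows "mfps_nth (billiard_form lam f chi v) m
    = of_nat (m $ v + 1) * mfps_nth (lagrangian f (\<lambda>i. rot (inv_rot lam) (chi i)) chi) (m + axis v 1)"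
proof -
  let ?cm = "\<lambda>i. rot (inv_rot lam) (chi i)" and ?cp = "\<lambda>i. rot lam (chi i)"
  let ?c = "case v of Inl j \<Rightarrow> lam $ j | Inr j \<Rightarrow> inverse (lam $ j)"
  have cm: "?cm j \<in> ord_ge 1" for j by (intro rot_ord_ge chi)
  have "mfps_nth (lagrangian_dy f chi ?cm j * mfps_deriv v (?cm j)) m
      = mfps_nth (lagrangian_dy f ?cp chi j * mfps_deriv v (chi j)) m" for j
  proof -
    have "mfps_deriv v (chi j) = mfps_const ?c * rot lam (mfps_deriv v (?cm j))"
      using mfps_deriv_rot[of v lam "?cm j"] by (simp add: rot_rot_inv lam)
    moreover have "lagrangian_dy f ?cp chi j = rot lam (lagrangian_dy f chi ?cm j)"
      using rot_lagrangian(2)[of chi ?cm f lam j] by (simp add: rot_rot_inv lam chi cm f0)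
    ultimately have "lagrangian_dy f ?cp chi j * mfps_deriv v (chi j)
        = mfps_const ?c * rot lam (lagrangian_dy f chi ?cm j * mfps_deriv v (?cm j))"
      by (simp add: rot_def scale.mult mult.left_commute)
    then have "mfps_nth (lagrangian_dy f ?cp chi j * mfps_deriv v (chi j)) m
        = ?c * multiplier lam m * mfps_nth (lagrangian_dy f chi ?cm j * mfps_deriv v (?cm j)) m"
      by (simp add: mfps_nth_rot mult.assoc)
    then show ?thesis using multiplier_balanced[OF lam m] by simp
  qed
  then have "mfps_nth (billiard_form lam f chi v) m = mfps_nth (mfps_deriv v (lagrangian f ?cm chi)) m"
    unfolding billiard_form_eq[OF chi] deriv_lagrangian[OF cm chi f0] euler_lagrange_def
    by (simp add: distrib_right sum.distrib)
  then show ?thesis by (simp add: mfps_nth_deriv)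
qed

section \<open>Linearisation\<close>

text \<open>Let \<open>c\<close> be the constant term of \<open>f\<close>, which has no linear term. So a change of \<open>x, y\<close> of order \<open>d\<close>, together with a change of \<open>f\<close>
  of order \<open>d + 1\<close>, reaches the quotient only through the terms \<open>y\<^sub>j - x\<^sub>j\<close> and \<open>\<partial>\<^sub>j f\<close> of the numerator;
  the changes of \<open>f(x) + f(y)\<close> and of the denominator are of order \<open>d + 1\<close>. In the remaining terms
  these two factors can be replaced by their constant terms \<open>2 c\<close> and \<open>\<surd>(4 c\<^sup>2)\<close>.\<close>
lemma lagrangian_dy_linearize:
  fixes f f' :: "(complex, 'n :: finite) mfps"
  assumes c: "c \<noteq> 0" and f: "f - mfps_const c \<in> ord_ge 2" and ff': "f' - f \<in> ord_ge (d + 1)"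
    and x: "\<And>v. x v \<in> ord_ge 1" and y: "\<And>v. y v \<in> ord_ge 1"
    and x': "\<And>v. x' v \<in> ord_ge 1" and y': "\<And>v. y' v \<in> ord_ge 1"
    and dx: "\<And>v. x' v - x v \<in> ord_ge d" and dy: "\<And>v. y' v - y v \<in> ord_ge d"
  shows "lagrangian_dy f' x' y' j - lagrangian_dy f x y j
     - mfps_const (inverse (csqrt (4 * c\<^sup>2))) * ((y' j - y j) - (x' j - x j)
         + mfps_const (2 * c) * (mfps_compose (mfps_deriv j f') y' - mfps_compose (mfps_deriv j f) y)) \<in> ord_ge (d + 1)"
    and "mfps_compose (mfps_deriv j f') y' - mfps_compose (mfps_deriv j f) y \<in> ord_ge d"
proof -
  have nf: "mfps_nth f 0 = c" using ord_ge_diffD[OF f, of 0] by (simp add: mfps_nth_const)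
  have nf': "mfps_nth f' 0 = c" using ord_ge_diffD[OF ff', of 0] nf by simp
  let ?S = "mfps_compose f x + mfps_compose f y" and ?S' = "mfps_compose f' x' + mfps_compose f' y'"
  let ?D = "mfps_compose (mfps_deriv j f) y" and ?D' = "mfps_compose (mfps_deriv j f') y'"
  let ?N = "y j - x j + ?S * ?D" and ?N' = "y' j - x' j + ?S' * ?D'"
  let ?L = "lagrangian f x y" and ?L' = "lagrangian f' x' y'"
  let ?l = "csqrt (4 * c\<^sup>2)"
  have comp: "mfps_compose f' u' - mfps_compose f u \<in> ord_ge (d + 1)"
    if "\<And>v. u v \<in> ord_ge 1" "\<And>v. u' v \<in> ord_ge 1" "\<And>v. u' v - u v \<in> ord_ge d"
    for u u' :: "'n \<Rightarrow> 'n zseries"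
  proof -
    have "mfps_compose f' u' - mfps_compose f u = mfps_compose (f' - f) u'
        + (mfps_compose (f - mfps_const c) u' - mfps_compose (f - mfps_const c) u)"
      by (simp add: mfps_compose_diff)
    moreover have "mfps_compose (f' - f) u' \<in> ord_ge (d + 1)"
      by (intro mfps_compose_ord_ge that ff')
    moreover have "mfps_compose (f - mfps_const c) u' - mfps_compose (f - mfps_const c) u \<in> ord_ge (d + 1)"
      using mfps_compose_diff_ord_ge[of u' u d "f - mfps_const c" 2] that f by (simp flip: Suc_eq_plus1)
    ultimately show ?thesis by (simp only: ord_ge_add)
  qed
  have cx: "mfps_compose f' x' - mfps_compose f x \<in> ord_ge (d + 1)" by (intro comp x x' dx)
  have cy: "mfps_compose f' y' - mfps_compose f y \<in> ord_ge (d + 1)" by (intro comp y y' dy)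
  have S: "?S' - ?S \<in> ord_ge (d + 1)"
    using ord_ge_add[OF cx cy] by (simp add: algebra_simps)
  have df: "mfps_deriv j f \<in> ord_ge 1"
    using ord_ge_deriv[of "f - mfps_const c" 1 j] f by (simp add: mfps_deriv_diff numeral_2_eq_2)
  show D: "?D' - ?D \<in> ord_ge d"
  proof -
    have "?D' - ?D = mfps_compose (mfps_deriv j (f' - f)) y'
        + (mfps_compose (mfps_deriv j f) y' - mfps_compose (mfps_deriv j f) y)"
      by (simp add: mfps_compose_diff mfps_deriv_diff)
    moreover have "mfps_compose (mfps_deriv j (f' - f)) y' \<in> ord_ge d"
      using ff' by (intro mfps_compose_ord_ge y' ord_ge_deriv) (simp flip: Suc_eq_plus1)
    moreover have "mfps_compose (mfps_deriv j f) y' - mfps_compose (mfps_deriv j f) y \<in> ord_ge d"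
      using mfps_compose_diff_ord_ge[of y' y d "mfps_deriv j f" 1] y' y dy df by simp
    ultimately show ?thesis by (simp only: ord_ge_add)
  qed
  have S0: "?S - mfps_const (2 * c) \<in> ord_ge 1"
    unfolding ord_ge_1_iff by (simp add: mfps_nth_compose_0 nf mfps_nth_const)
  have Ndiff: "?N' - ?N - ((y' j - y j) - (x' j - x j) + mfps_const (2 * c) * (?D' - ?D)) \<in> ord_ge (d + 1)"
  proof -
    have "?N' - ?N - ((y' j - y j) - (x' j - x j) + mfps_const (2 * c) * (?D' - ?D))
        = (?S' - ?S) * ?D' + (?D' - ?D) * (?S - mfps_const (2 * c))"
      by (simp add: algebra_simps)
    then show ?thesis
      by (simp only:) (intro ord_ge_add ord_ge_mult_left S ord_ge_mult D S0)
  qed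
  have lin: "(y' j - y j) - (x' j - x j) + mfps_const (2 * c) * (?D' - ?D) \<in> ord_ge d"
    by (intro ord_ge_add ord_ge_diff dx dy ord_ge_mult_right D)
  have Nd: "?N' - ?N \<in> ord_ge d"
    using ord_ge_add[OF ord_ge_mono[OF Ndiff, of d] lin] by (simp only: diff_add_cancel le_add1)
  have "lagrangian_sq f' x' y' - lagrangian_sq f x y \<in> ord_ge (d + 1)"
  proof -
    have "(x' i - y' i)\<^sup>2 - (x i - y i)\<^sup>2 \<in> ord_ge (d + 1)" for i
    proof -
      have "(x' i - y' i)\<^sup>2 - (x i - y i)\<^sup>2 = ((x' i - x i) - (y' i - y i)) * ((x' i + x i) - (y' i + y i))"
        by (simp add: power2_eq_square algebra_simps)
      then show ?thesis
        by (simp only:) (intro ord_ge_mult ord_ge_diff ord_ge_add dx dy x x' y y')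
    qed
    moreover have "?S'\<^sup>2 - ?S\<^sup>2 \<in> ord_ge (d + 1)"
      unfolding power2_eq_square by (intro ord_ge_mult_diff S)
    moreover have "lagrangian_sq f' x' y' - lagrangian_sq f x y
        = (\<Sum>i\<in>UNIV. (x' i - y' i)\<^sup>2 - (x i - y i)\<^sup>2) + (?S'\<^sup>2 - ?S\<^sup>2)"
      by (simp add: lagrangian_sq_def sum_subtractf)
    ultimately show ?thesis by (simp add: ord_ge_add ord_ge_sum)
  qed
  then have L: "?L' - ?L \<in> ord_ge (d + 1)"
    unfolding lagrangian_eq by (rule ord_ge_sqrt_diff[rotated 2]) (simp_all add: nth_lagrangian_sq_0 x y x' y' nf nf' c)
  have L0: "mfps_nth ?L 0 = ?l" "mfps_nth ?L' 0 = ?l"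
    using nth_lagrangian_0[of x y f] nth_lagrangian_0[of x' y' f'] x y x' y' c by (simp_all add: nf nf')
  have iL: "inverse ?L' - inverse ?L \<in> ord_ge (d + 1)"
    using L by (rule ord_ge_inverse_diff[rotated 2]) (simp_all add: L0 c)
  have iL0: "inverse ?L - mfps_const (inverse ?l) \<in> ord_ge 1"
    using ord_ge_minus_const[of "inverse ?L"] by (simp add: mfps_nth_inverse_0 L0 c)
  let ?lin = "(y' j - y j) - (x' j - x j) + mfps_const (2 * c) * (?D' - ?D)"
  have "lagrangian_dy f' x' y' j - lagrangian_dy f x y j - mfps_const (inverse ?l) * ?lin
      = (inverse ?L' - inverse ?L) * ?N' + (?N' - ?N) * (inverse ?L - mfps_const (inverse ?l))
        + (?N' - ?N - ?lin) * mfps_const (inverse ?l)"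
    unfolding lagrangian_dy_def divide_mfps_def by (simp add: ring_distribs mult.commute)
  also have "\<dots> \<in> ord_ge (d + 1)"
    by (rule ord_ge_add[OF ord_ge_add[OF ord_ge_mult_left[OF iL] ord_ge_mult[OF Nd iL0]] ord_ge_mult_left[OF Ndiff]])
  finally show "lagrangian_dy f' x' y' j - lagrangian_dy f x y j - mfps_const (inverse ?l) * ?lin \<in> ord_ge (d + 1)" .
qed

section \<open>Positivity and multihomogeneity\<close>

text \<open>A sufficient condition for a coefficient of a product to be nonzero, since terms without
  negative coefficients do not cancel.\<close>
definition pos_at :: "nat ^ 'v \<Rightarrow> (complex, 'v :: finite) mfps \<Rightarrow> bool" where
  "pos_at m g \<longleftrightarrow> (\<forall>k. Im (mfps_nth g k) = 0 \<and> 0 \<le> Re (mfps_nth g k)) \<and> 0 < Re (mfps_nth g m)"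

lemma pos_at_mult:
  assumes f: "pos_at m f" and g: "pos_at n g" shows "pos_at (m + n) (f * g)"
proof -
  have Re: "Re (mfps_nth (f * g) k) = (\<Sum>p | fst p + snd p = k. Re (mfps_nth f (fst p)) * Re (mfps_nth g (snd p)))"
    and "Im (mfps_nth (f * g) k) = 0" for k
    using f g by (simp_all add: mfps_nth_mult pos_at_def case_prod_unfold)
  moreover have "0 \<le> Re (mfps_nth (f * g) k)" for k
    unfolding Re using f g by (intro sum_nonneg) (simp add: pos_at_def)
  moreover have "0 < Re (mfps_nth (f * g) (m + n))"
    unfolding Re
    by (rule sum_pos2[where i = "(m, n)"])
      (use f g finite_splits[of "m + n"] in \<open>auto simp: pos_at_def case_prod_unfold\<close>)
  ultimately show ?thesis by (simp add: pos_at_def)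
qed

lemma pos_at_1: "pos_at 0 1"
  by (simp add: pos_at_def mfps_nth_one)

lemma pos_at_prod:
  "(\<And>i. i \<in> A \<Longrightarrow> pos_at (m i) (g i)) \<Longrightarrow> pos_at (\<Sum>i\<in>A. m i) (\<Prod>i\<in>A. g i)"
  by (induction A rule: infinite_finite_induct) (auto intro: pos_at_1 pos_at_mult)

text \<open>The variable \<open>z\<^sub>j\<close> and its conjugate are both counted with the \<open>j\<close>-th degree; the series
  is homogeneous in each of these degrees.\<close>
definition multihom :: "nat ^ 'n \<Rightarrow> ('n :: finite) zseries \<Rightarrow> bool" where
  "multihom t g \<longleftrightarrow> (\<forall>m. mfps_nth g m \<noteq> 0 \<longrightarrow> (\<forall>j. m $ Inl j + m $ Inr j = t $ j))"

lemma multihom_mult: "multihom s f \<Longrightarrow> multihom t g \<Longrightarrow> multihom (s + t) (f * g)"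
  unfolding multihom_def
proof (intro allI impI)
  fix m j
  assume f: "\<forall>m. mfps_nth f m \<noteq> 0 \<longrightarrow> (\<forall>j. m $ Inl j + m $ Inr j = s $ j)"
    and g: "\<forall>m. mfps_nth g m \<noteq> 0 \<longrightarrow> (\<forall>j. m $ Inl j + m $ Inr j = t $ j)"
    and "mfps_nth (f * g) m \<noteq> 0"
  then obtain a b where "a + b = m" "mfps_nth f a \<noteq> 0" "mfps_nth g b \<noteq> 0"
    unfolding mfps_nth_mult by (auto elim!: sum.not_neutral_contains_not_neutral)
  then have "a $ Inl j + a $ Inr j = s $ j" "b $ Inl j + b $ Inr j = t $ j" "m = a + b"
    using f g by auto
  then show "m $ Inl j + m $ Inr j = (s + t) $ j" by simp
qed

lemma multihom_1: "multihom 0 1"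
  by (simp add: multihom_def mfps_nth_one)

lemma multihom_prod:
  "(\<And>i. i \<in> A \<Longrightarrow> multihom (t i) (g i)) \<Longrightarrow> multihom (\<Sum>i\<in>A. t i) (\<Prod>i\<in>A. g i)"
  by (induction A rule: infinite_finite_induct) (auto intro: multihom_1 multihom_mult)

lemma axis_add: "axis j (m + n) = axis j m + axis j (n :: nat)"
  by (simp add: vec_eq_iff axis_def)

lemma sum_axis: "(\<Sum>j\<in>UNIV. axis j (t $ j)) = t" for t :: "nat ^ 'n"
  by (simp add: vec_eq_iff axis_def if_distrib cong: if_cong)

lemma mfps_nth_X: "mfps_nth (mfps_X v) m = (if m = axis v 1 then 1 else 0)"
  by (simp add: mfps_X_def)

lemma mfps_nth_X_power: "mfps_nth (mfps_X v ^ k) m = (if m = axis v k then 1 else 0)"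
  using arg_cong[OF mfps_scaled_var_power[of 1 v k], of "\<lambda>g. mfps_nth g m"]
  by (simp split: if_splits)

section \<open>The spectrum of the linearised operator\<close>

locale billiard_data =
  fixes lam :: "complex ^ 'n" and f0 :: real and a :: "real ^ 'n"
  assumes norm_lam: "norm (lam $ j) = 1"
    and nonres: "nonresonant lam"
    and f0_neg: "f0 < 0"
    and a_pos: "a $ j > 0"
begin

lemma lam_nz: "lam $ j \<noteq> 0"
  using norm_lam[of j] by auto

lemma cnj_lam: "cnj (lam $ j) = inverse (lam $ j)"
  by (rule cnj_eq_inverse) (rule norm_lam)

text \<open>This is how nonresonance enters: only balanced monomials are fixed by the rotation.\<close>
lemma multiplier_eq_1:
  assumes "multiplier lam m = 1" shows "balanced m"
proof -
  define k :: "int ^ 'n" where "k = (\<chi> j. int (m $ Inl j) - int (m $ Inr j))"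
  have "(\<Prod>j\<in>UNIV. (lam $ j) powi (k $ j)) = multiplier lam m"
    by (simp add: multiplier_def k_def power_int_diff lam_nz divide_inverse power_inverse prod.distrib)
  then have "k = 0" using nonres assms by (simp add: nonresonant_def)
  then show ?thesis by (simp add: balanced_iff k_def vec_eq_iff)
qed

lemma multiplier_add_axis:
  "multiplier lam (m + axis v 1) = (case v of Inl j \<Rightarrow> lam $ j | Inr j \<Rightarrow> inverse (lam $ j)) * multiplier lam m"
proof -
  have eq: "multiplier lam m = (\<Prod>v\<in>UNIV. (case v of Inl j \<Rightarrow> lam $ j | Inr j \<Rightarrow> inverse (lam $ j)) ^ (m $ v))" for m
    by (simp add: multiplier_def UNIV_sum_prod)
  show ?thesis unfolding eq by (rule prod_power_add_axis)
qed

text \<open>The eigenvalue of the linearised Euler-Lagrange operator on a monomial, up to a constant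
  factor.\<close>
definition eigval :: "'n \<Rightarrow> nat ^ ('n + 'n) \<Rightarrow> complex" where
  "eigval j m = lam $ j + inverse (lam $ j) - multiplier lam m - inverse (multiplier lam m)"

text \<open>The function \<open>x + x\<^sup>-\<^sup>1\<close> takes the same value only at \<open>x\<close> and \<open>x\<^sup>-\<^sup>1\<close>, so the eigenvalue vanishes only
  if \<open>\<mu>\<close> is \<open>\<lambda>\<^sub>j\<close> or \<open>\<lambda>\<^sub>j\<^sup>-\<^sup>1\<close>. Multiplying the monomial by the conjugate of \<open>z\<^sub>j\<close>, or by \<open>z\<^sub>j\<close>, then makes it
  invariant under the rotation.\<close>
lemma eigval_eq_0:
  assumes "eigval j m = 0"
  shows "balanced (m + axis (Inl j) 1) \<or> balanced (m + axis (Inr j) 1)"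
proof -
  let ?\<mu> = "multiplier lam m"
  have nz: "?\<mu> \<noteq> 0" by (intro multiplier_nonzero lam_nz)
  have "(?\<mu> - lam $ j) * (?\<mu> * lam $ j - 1) = - (?\<mu> * lam $ j) * eigval j m"
    using nz lam_nz[of j] by (simp add: eigval_def field_simps)
  then have "?\<mu> = lam $ j \<or> ?\<mu> * lam $ j = 1" using assms by simp
  then show ?thesis
  proof
    assume "?\<mu> = lam $ j"
    then have "multiplier lam (m + axis (Inr j) 1) = 1" by (simp add: multiplier_add_axis lam_nz)
    then show ?thesis by (blast intro: multiplier_eq_1)
  next
    assume "?\<mu> * lam $ j = 1"
    then have "multiplier lam (m + axis (Inl j) 1) = 1" by (simp add: multiplier_add_axis mult.commute)
    then show ?thesis by (blast intro: multiplier_eq_1)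
  qed
qed

lemma cnj_eigval: "cnj (eigval j (zswap m)) = eigval j m"
  by (simp add: eigval_def cnj_lam multiplier_cnj norm_lam)

definition quad_coeff :: "'n \<Rightarrow> complex" where
  "quad_coeff j = (2 - lam $ j - inverse (lam $ j)) / (- 8 * complex_of_real f0)"

lemma quad_coeff_real: "quad_coeff j \<in> \<real>"
proof -
  have "cnj (quad_coeff j) = quad_coeff j" by (simp add: quad_coeff_def cnj_lam)
  then show ?thesis by (simp add: Reals_cnj_iff)
qed

definition chi1 :: "'n \<Rightarrow> 'n zseries" where
  "chi1 j = mfps_const (complex_of_real (a $ j)) * (mfps_X (Inl j) + mfps_X (Inr j))"

definition fbase :: "(complex, 'n) mfps" where
  "fbase = mfps_const (complex_of_real f0) + (\<Sum>j\<in>UNIV. mfps_const (quad_coeff j) * mfps_X j ^ 2)"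

lemma nth_chi1: "mfps_nth (chi1 j) m = (if m = axis (Inl j) 1 \<or> m = axis (Inr j) 1 then complex_of_real (a $ j) else 0)"
  by (auto simp: chi1_def mfps_nth_X axis_eq_axis)

lemma chi1_ord: "chi1 j \<in> ord_ge 1"
  unfolding ord_ge_1_iff by (simp add: nth_chi1 flip: mdeg_eq_0_iff)

lemma zswap_axis: "zswap (axis (Inl j) k) = axis (Inr j) k" "zswap (axis (Inr j) k) = axis (Inl j) (k :: nat)" for j :: 'n
  by (auto simp: vec_sum_eq_iff axis_def)

lemma zconj_chi1: "zconj (chi1 j) = chi1 j"
proof (rule mfps_eqI)
  fix m :: "nat ^ ('n + 'n)"
  have "zswap m = axis (Inl j) 1 \<longleftrightarrow> m = axis (Inr j) 1" "zswap m = axis (Inr j) 1 \<longleftrightarrow> m = axis (Inl j) 1"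
    by (metis zswap_axis zswap_zswap)+
  then show "mfps_nth (zconj (chi1 j)) m = mfps_nth (chi1 j) m"
    by (auto simp: mfps_nth_zconj nth_chi1)
qed

lemma deriv_chi1: "mfps_deriv v (chi1 j) = (if v = Inl j \<or> v = Inr j then mfps_const (complex_of_real (a $ j)) else 0)"
  by (auto simp: chi1_def mfps_deriv_const_mult mfps_deriv_add mfps_deriv_X)

lemma multihom_monom_subst: "multihom t (monom_subst chi1 t)"
proof -
  have 1: "multihom (axis j 1) (chi1 j)" for j
    by (auto simp: multihom_def nth_chi1 axis_def)
  have "multihom (axis j k) (chi1 j ^ k)" for j k
  proof (induction k)
    case 0
    have "axis j 0 = (0 :: nat ^ 'n)" by (simp add: vec_eq_iff axis_def)
    then show ?case by (simp only: power_0 multihom_1)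
  next
    case (Suc k)
    from multihom_mult[OF 1[of j] Suc.IH] show ?case by (simp flip: axis_add Suc_eq_plus1_left)
  qed
  then have "multihom (\<Sum>j\<in>UNIV. axis j (t $ j)) (monom_subst chi1 t)" by (rule multihom_prod)
  then show ?thesis by (simp add: sum_axis)
qed

text \<open>Explicitly, this is the product over \<open>j\<close> of \<open>a\<^sub>j\<close> to the power \<open>2 s\<^sub>j\<close> and of the central
  binomial coefficients \<open>2 s\<^sub>j choose s\<^sub>j\<close>.\<close>
definition diag_coeff :: "nat ^ 'n \<Rightarrow> complex" where
  "diag_coeff s = mfps_nth (monom_subst chi1 (s + s)) (zexp s s)"

lemma diag_coeff_real_nonzero: "diag_coeff s \<in> \<real>" "diag_coeff s \<noteq> 0"
proof -
  have 1: "pos_at (axis (Inl j) 1) (chi1 j)" "pos_at (axis (Inr j) 1) (chi1 j)" for j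
    using a_pos[of j] by (auto simp: pos_at_def nth_chi1)
  have 2: "pos_at (zexp (axis j k) (axis j k)) (chi1 j ^ (k + k))" for j k
  proof (induction k)
    case 0
    have "zexp (axis j 0) (axis j 0) = (0 :: nat ^ ('n + 'n))" by (simp add: vec_sum_eq_iff axis_def)
    then show ?case by (simp add: pos_at_1)
  next
    case (Suc k)
    have "zexp (axis j (Suc k)) (axis j (Suc k)) = axis (Inl j) 1 + (axis (Inr j) 1 + zexp (axis j k) (axis j k))"
      by (auto simp: vec_sum_eq_iff axis_def)
    then show ?case using pos_at_mult[OF 1(1) pos_at_mult[OF 1(2) Suc.IH]] by simp
  qed
  have "pos_at (\<Sum>j\<in>UNIV. zexp (axis j (s $ j)) (axis j (s $ j))) (monom_subst chi1 (s + s))"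
    unfolding vector_add_component by (intro pos_at_prod 2)
  moreover have "(\<Sum>j\<in>UNIV. zexp (axis j (s $ j)) (axis j (s $ j))) = zexp s s"
    by (simp add: vec_sum_eq_iff axis_def if_distrib cong: if_cong)
  ultimately show "diag_coeff s \<in> \<real>" "diag_coeff s \<noteq> 0"
    by (auto simp: diag_coeff_def pos_at_def complex_is_Real_iff)
qed

text \<open>By multihomogeneity a balanced coefficient of \<open>\<phi>(\<chi>\<^sup>(\<^sup>1\<^sup>))\<close> sees a single coefficient of \<open>\<phi>\<close>. This
  decouples the conditions on the coefficients of \<open>f\<close>.\<close>
lemma nth_compose_chi1:
  assumes \<phi>: "\<And>t. mfps_nth \<phi> t \<noteq> 0 \<Longrightarrow> \<exists>s. t = s + s"
  shows "mfps_nth (mfps_compose \<phi> chi1) (zexp s s) = mfps_nth \<phi> (s + s) * diag_coeff s"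
proof -
  have "mfps_nth \<phi> t * mfps_nth (monom_subst chi1 t) (zexp s s) = (if t = s + s then mfps_nth \<phi> (s + s) * diag_coeff s else 0)" for t
  proof (cases "t = s + s")
    case False
    then have "mfps_nth (monom_subst chi1 t) (zexp s s) = 0"
      using multihom_monom_subst[of t] by (force simp: multihom_def vec_eq_iff)
    with False show ?thesis by simp
  qed (simp add: diag_coeff_def)
  then show ?thesis by (simp add: mfps_compose_def mdeg_zexp)
qed

section \<open>Pairs with the required symmetries\<close>

text \<open>The conditions which are preserved while the pair is corrected: symmetry, reality and the
  prescribed terms of lowest degree.\<close>
definition admissible :: "(complex, 'n) mfps \<Rightarrow> ('n \<Rightarrow> 'n zseries) \<Rightarrow> bool" where
  "admissible f chi \<longleftrightarrow> (\<forall>m. mfps_nth f m \<noteq> 0 \<longrightarrow> (\<exists>s. m = s + s)) \<and> (\<forall>m. mfps_nth f m \<in> \<real>)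
     \<and> f - fbase \<in> ord_ge 3
     \<and> (\<forall>j. (\<forall>m. mfps_nth (chi j) m \<noteq> 0 \<longrightarrow> odd (mdeg m)) \<and> zconj (chi j) = chi j \<and> chi j - chi1 j \<in> ord_ge 2)"

lemma fbase_0: "mfps_nth fbase 0 = f0"
  by (simp add: fbase_def mfps_nth_const power2_eq_square mfps_nth_X flip: mdeg_eq_0_iff)

lemma fbase_ord: "fbase - mfps_const f0 \<in> ord_ge 2"
proof -
  have "mfps_X j ^ 2 \<in> ord_ge 2" for j :: 'n
    by (rule ord_geI) (auto simp: mfps_nth_X_power)
  then show ?thesis by (auto simp: fbase_def intro!: ord_ge_sum ord_ge_mult_right)
qed

lemma deriv_fbase: "mfps_deriv j fbase = mfps_const (2 * quad_coeff j) * mfps_X j"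
proof -
  have "mfps_deriv j fbase = (\<Sum>i\<in>UNIV. if i = j then mfps_const (2 * quad_coeff j) * mfps_X j else 0)"
    unfolding fbase_def mfps_deriv_add mfps_deriv_sum mfps_deriv_const add_0
    by (rule sum.cong) (auto simp: mfps_deriv_const_mult mfps_deriv_power2 mfps_deriv_X mfps_const_mult mfps_const_numeral)
  then show ?thesis by simp
qed

lemma admissible_base: "admissible fbase chi1"
proof -
  have nth: "mfps_nth fbase m = (if m = 0 then f0 else 0) + (\<Sum>j\<in>UNIV. quad_coeff j * (if m = axis j 2 then 1 else 0))" for m
    by (simp add: fbase_def mfps_nth_const mfps_nth_X_power)
  have "\<exists>s. m = s + s" if "mfps_nth fbase m \<noteq> 0" for m
  proof (rule ccontr)
    assume *: "\<nexists>s. m = s + s"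
    have "m \<noteq> 0" using * by (metis add_0)
    moreover have "m \<noteq> axis j 2" for j
      using * axis_add[of j 1 1] by (metis one_add_one)
    ultimately have "m \<noteq> 0" "m \<noteq> axis j 2" for j by auto
    with that show False by (simp add: nth)
  qed
  moreover have "mfps_nth fbase m \<in> \<real>" for m
    unfolding nth by (intro Reals_add sum_in_Reals Reals_mult quad_coeff_real) auto
  moreover have "odd (mdeg m)" if "mfps_nth (chi1 j) m \<noteq> 0" for j m
    using that by (auto simp: nth_chi1 split: if_splits)
  ultimately show ?thesis by (simp add: admissible_def zconj_chi1)
qed

context
  fixes f chi assumes adm: "admissible f chi"
begin

lemma f_even: "mfps_nth f t \<noteq> 0 \<Longrightarrow> \<exists>s. t = s + s" and f_real: "mfps_nth f t \<in> \<real>"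
  and f_base: "f - fbase \<in> ord_ge 3"
  and chi_odd: "mfps_nth (chi j) m \<noteq> 0 \<Longrightarrow> odd (mdeg m)" and chi_real: "zconj (chi j) = chi j"
  and chi_base: "chi j - chi1 j \<in> ord_ge 2"
  using adm by (auto simp: admissible_def)

lemma chi_ord: "chi j \<in> ord_ge 1"
proof -
  have "chi j - chi1 j \<in> ord_ge 1" by (rule ord_ge_mono[OF chi_base]) simp
  from ord_ge_add[OF this chi1_ord[of j]] show ?thesis by simp
qed

lemma f_ord: "f - mfps_const f0 \<in> ord_ge 2"
  using ord_ge_trans[OF ord_ge_mono[OF f_base, of 2] fbase_ord] by simp

lemma f_0: "mfps_nth f 0 = f0"
  using ord_ge_diffD[OF f_base, of 0] by (simp add: fbase_0)

lemma f_0_nz: "mfps_nth f 0 \<noteq> 0"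
  using f0_neg by (simp add: f_0)

lemma deriv_f_ord: "mfps_deriv j f - mfps_const (2 * quad_coeff j) * mfps_X j \<in> ord_ge 2"
  using ord_ge_deriv[of "f - fbase" 2 j] f_base by (simp add: mfps_deriv_diff deriv_fbase)

lemma deriv_chi_0: "mfps_nth (mfps_deriv v (chi j)) 0 = (if v = Inl j \<or> v = Inr j then a $ j else 0)"
proof -
  have "mfps_deriv v (chi j) - mfps_deriv v (chi1 j) \<in> ord_ge 1"
    unfolding mfps_deriv_diff[symmetric] using chi_base[of j] by (intro ord_ge_deriv) (simp add: numeral_2_eq_2 One_nat_def)
  from ord_ge_diffD[OF this, of 0] show ?thesis by (simp add: deriv_chi1 mfps_nth_const)
qed

lemma scale_f: "(\<And>i. c i = 1 \<or> c i = -1) \<Longrightarrow> mfps_scale c f = f"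
proof (rule mfps_eqI)
  fix m assume c: "\<And>i. c i = 1 \<or> c i = -1"
  have "(\<Prod>v\<in>UNIV. c v ^ (m $ v)) = 1" if "mfps_nth f m \<noteq> 0"
  proof -
    obtain s where m: "m = s + s" using f_even \<open>mfps_nth f m \<noteq> 0\<close> by blast
    have "c v ^ (s $ v + s $ v) = 1" for v using c[of v] by (auto simp flip: mult_2)
    then show ?thesis by (simp add: m)
  qed
  then show "mfps_nth (mfps_scale c f) m = mfps_nth f m" by (auto simp: mfps_nth_scale)
qed

lemma scale_chi: "mfps_scale (\<lambda>_. -1) (chi j) = - chi j"
proof (rule mfps_eqI)
  fix m :: "nat ^ ('n + 'n)"
  have "(\<Prod>v\<in>UNIV. (-1) ^ (m $ v) :: complex) = (-1) ^ mdeg m"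
    by (simp add: mdeg_def power_sum)
  then show "mfps_nth (mfps_scale (\<lambda>_. -1) (chi j)) m = mfps_nth (- chi j) m"
    using chi_odd[of j m] by (cases "mfps_nth (chi j) m = 0") (simp_all add: mfps_nth_scale)
qed

lemma csqrt_f0: "csqrt (4 * (mfps_nth f 0)\<^sup>2) = complex_of_real (- 2 * f0)"
proof -
  have "4 * (mfps_nth f 0)\<^sup>2 = complex_of_real ((2 * f0)\<^sup>2)" by (simp add: f_0)
  then show ?thesis using f0_neg by (simp only: csqrt_of_real zero_le_power2 real_sqrt_abs) simp
qed

lemma f_map_cnj: "mfps_map cnj f = f"
  by (rule mfps_eqI) (use f_real in \<open>simp add: mfps_map_def Reals_cnj_iff\<close>)

lemma zconj_euler_lagrange: "zconj (euler_lagrange lam f chi j) = euler_lagrange lam f chi j"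
proof -
  have n: "norm (inv_rot lam $ j) = 1" for j by (simp add: inv_rot_def norm_inverse norm_lam)
  have "zconj (lagrangian_dy f (\<lambda>i. rot \<mu> (chi i)) chi j) = lagrangian_dy f (\<lambda>i. rot \<mu> (chi i)) chi j"
    if "\<And>j. norm (\<mu> $ j) = 1" for \<mu>
    by (subst series_hom_lagrangian(2)[OF zconj.series_hom_axioms])
      (simp_all add: rot_ord_ge chi_ord f_0_nz f_map_cnj csqrt_f0 zconj_rot that chi_real)
  then show ?thesis by (simp add: euler_lagrange_def zconj.add norm_lam n)
qed

lemma zconj_lagrangian:
  "zconj (lagrangian f (\<lambda>i. rot (inv_rot lam) (chi i)) chi) = lagrangian f (\<lambda>i. rot (inv_rot lam) (chi i)) chi"
proof -
  have n: "norm (inv_rot lam $ j) = 1" for j by (simp add: inv_rot_def norm_inverse norm_lam)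
  show ?thesis
    by (subst series_hom_lagrangian(1)[OF zconj.series_hom_axioms])
      (simp_all add: rot_ord_ge chi_ord f_0_nz f_map_cnj csqrt_f0 zconj_rot n chi_real)
qed

lemma nth_lagrangian_real:
  assumes "balanced m"
  shows "mfps_nth (lagrangian f (\<lambda>i. rot (inv_rot lam) (chi i)) chi) m \<in> \<real>"
  using arg_cong[OF zconj_lagrangian, of "\<lambda>g. mfps_nth g m"]
  by (simp add: mfps_nth_zconj zswap_balanced[OF assms] Reals_cnj_iff)

text \<open>Reflecting all variables commutes with the rotation, changes the sign of \<open>\<chi>\<close> and of
  \<open>\<partial>\<^sub>j f\<close>, and leaves the even series \<open>f\<close> and the Lagrangian unchanged.\<close>
lemma euler_lagrange_odd:
  assumes "mfps_nth (euler_lagrange lam f chi j) m \<noteq> 0" shows "odd (mdeg m)"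
proof -
  let ?N = "mfps_scale (\<lambda>_. -1) :: 'n zseries \<Rightarrow> _"
  have Nr: "?N (rot \<mu> g) = rot \<mu> (?N g)" for \<mu> g
    by (rule mfps_eqI) (simp add: mfps_nth_scale mfps_nth_rot)
  have neg: "mfps_compose g (\<lambda>v. - u v) = mfps_compose (mfps_scale (\<lambda>_. -1) g) u"
    for g :: "(complex, 'n) mfps" and u :: "'n \<Rightarrow> 'n zseries"
    using mfps_compose_scaled[of g "\<lambda>_. -1" u] by (simp add: mfps_const_uminus)
  have df: "mfps_scale (\<lambda>_. -1) (mfps_deriv j f) = - mfps_deriv j f"
    using mfps_deriv_scale[of j "\<lambda>_. -1" f] scale_f[of "\<lambda>_. -1"]
    by (simp add: mfps_const_uminus) (metis minus_minus)
  have L: "lagrangian f (\<lambda>v. - x v) (\<lambda>v. - y v) = lagrangian f x y" for x y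
    unfolding lagrangian_def neg by (simp add: scale_f power2_commute)
  have "?N (lagrangian_dy f (\<lambda>i. rot \<mu> (chi i)) chi j) = - lagrangian_dy f (\<lambda>i. rot \<mu> (chi i)) chi j" for \<mu>
  proof -
    have "?N (lagrangian_dy f (\<lambda>i. rot \<mu> (chi i)) chi j) = lagrangian_dy f (\<lambda>i. - rot \<mu> (chi i)) (\<lambda>i. - chi i) j"
      by (subst series_hom_lagrangian(2)[OF scale.series_hom_axioms])
        (simp_all add: rot_ord_ge chi_ord f_0_nz Nr scale_chi rot_uminus)
    also have "\<dots> = - lagrangian_dy f (\<lambda>i. rot \<mu> (chi i)) chi j"
      unfolding lagrangian_dy_def L neg df divide_mfps_def
      by (simp add: scale_f mfps_compose_uminus algebra_simps)
    finally show ?thesis .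
  qed
  then have "?N (euler_lagrange lam f chi j) = - euler_lagrange lam f chi j"
    by (simp add: euler_lagrange_def scale.add)
  from arg_cong[OF this, of "\<lambda>g. mfps_nth g m"]
  have "(-1) ^ mdeg m * mfps_nth (euler_lagrange lam f chi j) m = - mfps_nth (euler_lagrange lam f chi j) m"
    by (simp add: mfps_nth_scale mdeg_def power_sum)
  then show ?thesis using assms by (cases "even (mdeg m)") auto
qed

end

section \<open>Solving degree by degree\<close>

text \<open>Both neighbours of \<open>\<chi>\<close> contribute, which gives the second difference of \<open>\<chi>' - \<chi>\<close> along the
  rotation. Since \<open>f\<^sub>0\<close> is negative, the constant term of the Lagrangian is \<open>-2 f\<^sub>0\<close>, which explains the sign.\<close>
lemma euler_lagrange_linearize:
  assumes f: "f - mfps_const f0 \<in> ord_ge 2" and ff': "f' - f \<in> ord_ge (d + 1)"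
    and chi: "\<And>j. chi j \<in> ord_ge 1" and chi': "\<And>j. chi' j \<in> ord_ge 1"
    and dchi: "\<And>j. chi' j - chi j \<in> ord_ge d"
  defines "\<Delta> \<equiv> \<lambda>j. mfps_compose (mfps_deriv j f') chi' - mfps_compose (mfps_deriv j f) chi"
  shows "mdeg m \<le> d \<Longrightarrow> mfps_nth (euler_lagrange lam f' chi' j) m = mfps_nth (euler_lagrange lam f chi j) m
      - ((2 - multiplier lam m - inverse (multiplier lam m)) * mfps_nth (chi' j - chi j) m
         + 4 * f0 * mfps_nth (\<Delta> j) m) / (2 * f0)"
    and "euler_lagrange lam f' chi' j - euler_lagrange lam f chi j \<in> ord_ge d"
proof -
  let ?h = "inverse (csqrt (4 * (complex_of_real f0)\<^sup>2))"
  let ?\<eta> = "chi' j - chi j"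
  let ?lin = "\<lambda>\<mu>. ?\<eta> - rot \<mu> ?\<eta> + mfps_const (2 * f0) * \<Delta> j"
  let ?P = "\<lambda>f chi \<mu>. lagrangian_dy f (\<lambda>i. rot \<mu> (chi i)) chi j"
  have "4 * (complex_of_real f0)\<^sup>2 = complex_of_real ((2 * f0)\<^sup>2)" by simp
  then have h: "?h = - 1 / (2 * f0)"
    using f0_neg by (simp only: csqrt_of_real zero_le_power2 real_sqrt_abs) (simp add: field_simps)
  have P: "?P f' chi' \<mu> - ?P f chi \<mu> - mfps_const ?h * ?lin \<mu> \<in> ord_ge (d + 1)" and D: "\<Delta> j \<in> ord_ge d" for \<mu>
  proof -
    have r: "rot \<mu> (chi' i) - rot \<mu> (chi i) \<in> ord_ge d" for i
      unfolding rot_diff[symmetric] by (intro rot_ord_ge dchi)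
    have f0: "complex_of_real f0 \<noteq> 0" using f0_neg by simp
    note L = lagrangian_dy_linearize[where c = "complex_of_real f0" and f = f and f' = f' and d = d
        and x = "\<lambda>i. rot \<mu> (chi i)" and y = chi and x' = "\<lambda>i. rot \<mu> (chi' i)" and y' = chi' and j = j]
    show "?P f' chi' \<mu> - ?P f chi \<mu> - mfps_const ?h * ?lin \<mu> \<in> ord_ge (d + 1)"
      using L(1) f0 f ff' chi chi' dchi r by (simp add: rot_diff \<Delta>_def rot_ord_ge)
    show "\<Delta> j \<in> ord_ge d" using L(2) f0 f ff' chi chi' dchi r by (simp add: \<Delta>_def rot_ord_ge)
  qed
  show "mfps_nth (euler_lagrange lam f' chi' j) m = mfps_nth (euler_lagrange lam f chi j) m
      - ((2 - multiplier lam m - inverse (multiplier lam m)) * mfps_nth (chi' j - chi j) m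
         + 4 * f0 * mfps_nth (\<Delta> j) m) / (2 * f0)" if "mdeg m \<le> d"
  proof -
    have "mfps_nth (?P f' chi' \<mu>) m = mfps_nth (?P f chi \<mu>) m + ?h * mfps_nth (?lin \<mu>) m" for \<mu>
    proof -
      have "mfps_nth (?P f' chi' \<mu> - ?P f chi \<mu>) m = mfps_nth (mfps_const ?h * ?lin \<mu>) m"
        by (rule ord_ge_diffD[OF P]) (use that in simp)
      then show ?thesis by (simp only: mfps_nth_diff mfps_nth_const_mult diff_eq_eq add.commute)
    qed
    moreover have "mfps_nth (?lin \<mu>) m = (1 - multiplier \<mu> m) * mfps_nth ?\<eta> m + 2 * f0 * mfps_nth (\<Delta> j) m" for \<mu>
      by (simp add: mfps_nth_rot ring_distribs)
    ultimately have "mfps_nth (?P f' chi' \<mu>) m = mfps_nth (?P f chi \<mu>) m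
        - ((1 - multiplier \<mu> m) * mfps_nth ?\<eta> m + 2 * f0 * mfps_nth (\<Delta> j) m) / (2 * f0)" for \<mu>
      unfolding h by simp
    then show ?thesis
      unfolding euler_lagrange_def mfps_nth_add multiplier_inv_rot
      by (simp only: multiplier_inv_rot) (simp add: add_divide_distrib diff_divide_distrib left_diff_distrib)
  qed
  have "?P f' chi' \<mu> - ?P f chi \<mu> \<in> ord_ge d" for \<mu>
  proof -
    have "?lin \<mu> \<in> ord_ge d" by (intro ord_ge_add ord_ge_diff rot_ord_ge dchi ord_ge_mult_right D)
    then have "mfps_const ?h * ?lin \<mu> \<in> ord_ge d" by (rule ord_ge_mult_right)
    from ord_ge_add[OF ord_ge_mono[OF P[of \<mu>], of d] this] show ?thesis by (simp only: diff_add_cancel le_add1)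
  qed
  from ord_ge_add[OF this[of "inv_rot lam"] this[of lam]]
  show "euler_lagrange lam f' chi' j - euler_lagrange lam f chi j \<in> ord_ge d"
    by (simp add: euler_lagrange_def algebra_simps)
qed

text \<open>The reason for the prescribed quadratic part of \<open>f\<close>: it shifts the spectrum of the second
  difference so that the variables \<open>z\<^sub>j\<close> and their conjugates lie in the kernel.\<close>
lemma eigval_quad_coeff: "2 - multiplier lam m - inverse (multiplier lam m) + 8 * f0 * quad_coeff j = eigval j m"
  using f0_neg by (simp add: eigval_def quad_coeff_def field_simps)

text \<open>The linear part of the equation, obtained by linearising at \<open>\<chi> = 0\<close> with constant \<open>f\<close>. Both
  monomials of \<open>\<chi>\<^sup>(\<^sup>1\<^sup>)\<^sub>j\<close> are in the kernel of the linearised operator; oddness adds one more degree.\<close>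
lemma euler_lagrange_base: "euler_lagrange lam fbase chi1 j \<in> ord_ge 3"
proof -
  have 0: "euler_lagrange lam (mfps_const (complex_of_real f0)) (\<lambda>_. 0) j = 0"
    by (simp add: euler_lagrange_def lagrangian_dy_def divide_mfps_def rot_def scale.zero
        mfps_compose_const[of 0, simplified])
  have "euler_lagrange lam fbase chi1 j \<in> ord_ge (2 * 1)"
  proof (rule ord_geI)
    fix m :: "nat ^ ('n + 'n)" assume "mdeg m < 2 * 1"
    then have m: "mdeg m \<le> 1" by simp
    have D: "mfps_compose (mfps_deriv j fbase) chi1 = mfps_const (2 * quad_coeff j) * chi1 j"
      by (simp add: deriv_fbase mfps_compose_const_mult mfps_compose_X chi1_ord)
    have "mfps_nth (euler_lagrange lam fbase chi1 j) m =
       0 - ((2 - multiplier lam m - inverse (multiplier lam m)) * mfps_nth (chi1 j) m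
         + 4 * f0 * (2 * quad_coeff j * mfps_nth (chi1 j) m)) / (2 * f0)"
      using euler_lagrange_linearize(1)[of "mfps_const f0" fbase 1 "\<lambda>_. 0" chi1 m j] fbase_ord m
      by (simp add: 0 D chi1_ord mfps_compose_const[of 0, simplified])
    also have "\<dots> = 0 - (eigval j m * mfps_nth (chi1 j) m) / (2 * f0)"
      by (simp add: eigval_quad_coeff[of m j, symmetric] algebra_simps)
    also have "eigval j m * mfps_nth (chi1 j) m = 0"
    proof (cases "mfps_nth (chi1 j) m = 0")
      case False
      then have "m = 0 + axis (Inl j) 1 \<or> m = 0 + axis (Inr j) 1"
        by (auto simp: nth_chi1 split: if_splits)
      moreover have "multiplier lam 0 = 1" by (simp add: multiplier_def)
      ultimately have "multiplier lam m = lam $ j \<or> multiplier lam m = inverse (lam $ j)"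
        using multiplier_add_axis[of 0] by auto
      then show ?thesis by (auto simp: eigval_def)
    qed simp
    finally show "mfps_nth (euler_lagrange lam fbase chi1 j) m = 0" by simp
  qed
  then have "euler_lagrange lam fbase chi1 j \<in> ord_ge (2 * 1 + 1)"
    by (rule ord_ge_odd) (rule euler_lagrange_odd[OF admissible_base])
  then show ?thesis by simp
qed

text \<open>One step of the induction, raising the order of the Euler-Lagrange series by two. First \<open>\<phi>\<close>
  is chosen such that the resonant terms cancel, then \<open>\<eta>\<close> by dividing the other terms by their
  eigenvalues.\<close>
lemma raise_order:
  assumes adm: "admissible f chi" and W: "\<And>j. euler_lagrange lam f chi j \<in> ord_ge (2 * k + 3)"
  shows "\<exists>f' chi'. admissible f' chi' \<and> (\<forall>j. euler_lagrange lam f' chi' j \<in> ord_ge (2 * k + 5))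
     \<and> f' - f \<in> ord_ge (2 * k + 4) \<and> (\<forall>j. chi' j - chi j \<in> ord_ge (2 * k + 3))"
proof -
  define d where "d = 2 * k + 3"
  let ?W = "euler_lagrange lam f chi"
  define G where "G = lagrangian f (\<lambda>i. rot (inv_rot lam) (chi i)) chi"
  \<comment> \<open>The value is the one for which the balanced coefficients of \<open>\<phi>(\<chi>\<^sup>(\<^sup>1\<^sup>))\<close> in degree \<open>d + 1\<close>
    are half of those of \<open>G\<close>; see the last steps of \<open>resonant\<close>.\<close>
  define \<phi> :: "(complex, 'n) mfps" where "\<phi> = Abs_mfps (\<lambda>t. if mdeg t = d + 1 \<and> (\<exists>s. t = s + s)
      then (let s = (\<chi> i. t $ i div 2) in mfps_nth G (zexp s s) / (2 * diag_coeff s)) else 0)"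
  define E where "E j = mfps_compose (mfps_deriv j \<phi>) chi1" for j
  \<comment> \<open>At a resonant monomial the quotient has denominator zero and is \<open>0\<close>, as it should be.\<close>
  define \<eta> where "\<eta> j = Abs_mfps (\<lambda>m. if mdeg m = d
      then (2 * f0 * mfps_nth (?W j) m - 4 * f0 * mfps_nth (E j) m) / eigval j m else 0)" for j
  have \<phi>_nth: "mfps_nth \<phi> (s + s) = (if mdeg (s + s) = d + 1 then mfps_nth G (zexp s s) / (2 * diag_coeff s) else 0)" for s
  proof -
    have "(\<chi> i. (s + s) $ i div 2) = s" by (simp add: vec_eq_iff)
    then show ?thesis by (auto simp: \<phi>_def Let_def)
  qed
  have \<phi>_even: "\<exists>s. t = s + s" if "mfps_nth \<phi> t \<noteq> 0" for t
    using that by (auto simp: \<phi>_def split: if_splits)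
  have \<phi>_ord: "\<phi> \<in> ord_ge (d + 1)" by (rule ord_geI) (simp add: \<phi>_def)
  have \<phi>_real: "mfps_nth \<phi> t \<in> \<real>" for t
  proof (cases "mfps_nth \<phi> t = 0")
    case False
    then obtain s where t: "t = s + s" using \<phi>_even by blast
    have "mfps_nth G (zexp s s) \<in> \<real>"
      unfolding G_def by (rule nth_lagrangian_real[OF adm]) (auto simp: balanced_def)
    then show ?thesis unfolding t \<phi>_nth by (simp add: diag_coeff_real_nonzero)
  qed simp
  have E_ord: "E j \<in> ord_ge d" for j
    unfolding E_def using \<phi>_ord by (intro mfps_compose_ord_ge chi1_ord ord_ge_deriv) (simp flip: Suc_eq_plus1)
  have \<eta>_ord: "\<eta> j \<in> ord_ge d" for j by (rule ord_geI) (simp add: \<eta>_def)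
  \<comment> \<open>The coefficients at \<open>m\<close> of \<open>a\<^sub>j W\<^sub>j\<close> and \<open>a\<^sub>j E\<^sub>j\<close> are coefficients of differentials: the first of
    \<open>d\<langle>G\<rangle>\<close>, as the form is \<open>\<Sum>\<^sub>i W\<^sub>i d\<chi>\<^sup>(\<^sup>1\<^sup>)\<^sub>i\<close> in its lowest degree \<open>d\<close>, the second of \<open>d \<phi>(\<chi>\<^sup>(\<^sup>1\<^sup>))\<close>.\<close>
  have resonant: "2 * f0 * mfps_nth (?W j) m = 4 * f0 * mfps_nth (E j) m"
    if m: "mdeg m = d" and 0: "eigval j m = 0" for j m
  proof -
    obtain v where v: "v = Inl j \<or> v = Inr j" and b: "balanced (m + axis v 1)"
      using eigval_eq_0[OF 0] by blast
    then obtain s where s: "m + axis v 1 = zexp s s" by (auto simp: balanced_def)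
    have deg: "mdeg (s + s) = d + 1"
      using arg_cong[OF s, of mdeg] m by (simp add: mdeg_zexp)
    have vi: "(v = Inl i \<or> v = Inr i) \<longleftrightarrow> i = j" for i using v by auto
    have "a $ j * mfps_nth (?W j) m = (\<Sum>i\<in>UNIV. if i = j then a $ j * mfps_nth (?W j) m else 0)"
      by simp
    also have "\<dots> = (\<Sum>i\<in>UNIV. mfps_nth (?W i * mfps_deriv v (chi i)) m)"
    proof (rule sum.cong)
      fix i
      have "?W i \<in> ord_ge (mdeg m)" using W[of i] m by (simp add: d_def)
      then show "(if i = j then a $ j * mfps_nth (?W j) m else 0) = mfps_nth (?W i * mfps_deriv v (chi i)) m"
        by (simp add: mfps_nth_mult_lowest deriv_chi_0[OF adm] vi)
    qed simp
    also have "\<dots> = mfps_nth (billiard_form lam f chi v) m"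
      by (simp add: billiard_form_eq chi_ord[OF adm])
    also have "\<dots> = of_nat (m $ v + 1) * mfps_nth G (zexp s s)"
      unfolding G_def s[symmetric]
      by (rule billiard_form_balanced) (simp_all add: lam_nz chi_ord[OF adm] f_0_nz[OF adm] b)
    finally have 1: "a $ j * mfps_nth (?W j) m = of_nat (m $ v + 1) * mfps_nth G (zexp s s)" .
    have "mfps_deriv v (mfps_compose \<phi> chi1) = (\<Sum>i\<in>UNIV. if i = j then mfps_const (complex_of_real (a $ j)) * E j else 0)"
      unfolding mfps_deriv_compose[OF chi1_ord] by (rule sum.cong) (simp_all add: deriv_chi1 vi E_def mult.commute)
    then have "a $ j * mfps_nth (E j) m = mfps_nth (mfps_deriv v (mfps_compose \<phi> chi1)) m"
      by simp
    also have "\<dots> = of_nat (m $ v + 1) * (mfps_nth \<phi> (s + s) * diag_coeff s)"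
      unfolding mfps_nth_deriv s using \<phi>_even by (simp add: nth_compose_chi1)
    also have "mfps_nth \<phi> (s + s) * diag_coeff s = mfps_nth G (zexp s s) / 2"
      by (simp add: \<phi>_nth deg[simplified] diag_coeff_real_nonzero)
    finally have "a $ j * (mfps_nth (?W j) m - 2 * mfps_nth (E j) m) = 0"
      using 1 by (simp add: algebra_simps)
    then show ?thesis using a_pos[of j] by auto
  qed
  have solve: "2 * f0 * mfps_nth (?W j) m = eigval j m * mfps_nth (\<eta> j) m + 4 * f0 * mfps_nth (E j) m"
    if "mdeg m \<le> d" for j m
  proof (cases "mdeg m = d")
    case True
    then show ?thesis using resonant[OF True] by (cases "eigval j m = 0") (simp_all add: \<eta>_def field_simps)
  next
    case False
    then have "mdeg m < d" using that by simp
    then show ?thesis using W[of j] E_ord[of j] \<eta>_ord[of j] by (simp add: ord_geD d_def)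
  qed
  define f' where "f' = f + \<phi>"
  define chi' where "chi' j = chi j + \<eta> j" for j
  have d3: "3 \<le> d" by (simp add: d_def)
  have zE: "zconj (E j) = E j" for j
  proof -
    have "mfps_map cnj (mfps_deriv j \<phi>) = mfps_deriv j \<phi>"
      by (rule mfps_eqI) (use \<phi>_real in \<open>simp add: mfps_map_def mfps_nth_deriv Reals_cnj_iff\<close>)
    then show ?thesis by (simp add: E_def zconj.compose chi1_ord zconj_chi1)
  qed
  have z\<eta>: "zconj (\<eta> j) = \<eta> j" for j
  proof (rule mfps_eqI)
    fix m
    have "cnj (mfps_nth (?W j) (zswap m)) = mfps_nth (?W j) m" "cnj (mfps_nth (E j) (zswap m)) = mfps_nth (E j) m"
      using arg_cong[OF zconj_euler_lagrange[OF adm, of j], of "\<lambda>g. mfps_nth g m"]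
        arg_cong[OF zE[of j], of "\<lambda>g. mfps_nth g m"] by (simp_all add: mfps_nth_zconj)
    then show "mfps_nth (zconj (\<eta> j)) m = mfps_nth (\<eta> j) m"
      by (simp add: mfps_nth_zconj \<eta>_def cnj_eigval)
  qed
  have adm': "admissible f' chi'"
    unfolding admissible_def
  proof (intro conjI allI impI)
    fix t assume *: "mfps_nth f' t \<noteq> 0"
    then have "mfps_nth f t \<noteq> 0 \<or> mfps_nth \<phi> t \<noteq> 0" by (auto simp: f'_def)
    then show "\<exists>s. t = s + s" using f_even[OF adm] \<phi>_even by blast
  next
    fix t show "mfps_nth f' t \<in> \<real>" by (simp add: f'_def f_real[OF adm] \<phi>_real)
  next
    have "\<phi> \<in> ord_ge 3" by (rule ord_ge_mono[OF \<phi>_ord]) (use d3 in simp)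
    from ord_ge_add[OF f_base[OF adm] this] show "f' - fbase \<in> ord_ge 3" by (simp add: f'_def algebra_simps)
  next
    fix j m assume "mfps_nth (chi' j) m \<noteq> 0"
    then have "mfps_nth (chi j) m \<noteq> 0 \<or> mfps_nth (\<eta> j) m \<noteq> 0" by (auto simp: chi'_def)
    then show "odd (mdeg m)"
      using chi_odd[OF adm] by (auto simp: \<eta>_def d_def split: if_splits)
  next
    fix j show "zconj (chi' j) = chi' j" by (simp add: chi'_def zconj.add chi_real[OF adm] z\<eta>)
  next
    fix j
    have "\<eta> j \<in> ord_ge 2" by (rule ord_ge_mono[OF \<eta>_ord]) (use d3 in simp)
    from ord_ge_add[OF chi_base[OF adm] this] show "chi' j - chi1 j \<in> ord_ge 2" by (simp add: chi'_def algebra_simps)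
  qed
  \<comment> \<open>Of the change of \<open>(\<partial>\<^sub>j f)(\<chi>)\<close> only two contributions are of degree \<open>d\<close>: the linear part of
    \<open>\<partial>\<^sub>j f\<close> applied to \<open>\<eta>\<close>, and \<open>\<partial>\<^sub>j \<phi>\<close> applied to the linear part of \<open>\<chi>\<close>.\<close>
  have \<Delta>: "mfps_compose (mfps_deriv j f') chi' - mfps_compose (mfps_deriv j f) chi
      - (mfps_const (2 * quad_coeff j) * \<eta> j + E j) \<in> ord_ge (d + 1)" for j
  proof -
    let ?r = "mfps_deriv j f - mfps_const (2 * quad_coeff j) * mfps_X j"
    have 1: "mfps_compose (mfps_deriv j \<phi>) chi' - E j \<in> ord_ge (d + 1)"
    proof -
      have "mfps_compose (mfps_deriv j \<phi>) chi' - E j \<in> ord_ge (2 + (d - 1))"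
        unfolding E_def using \<phi>_ord
        by (intro mfps_compose_diff_ord_ge chi_ord[OF adm'] chi1_ord chi_base[OF adm'] ord_ge_deriv) (simp flip: Suc_eq_plus1)
      then show ?thesis by (rule ord_ge_mono) (use d3 in simp)
    qed
    have 2: "mfps_compose ?r chi' - mfps_compose ?r chi \<in> ord_ge (d + 1)"
    proof -
      have "mfps_compose ?r chi' - mfps_compose ?r chi \<in> ord_ge (d + (2 - 1))"
        by (intro mfps_compose_diff_ord_ge chi_ord[OF adm'] chi_ord[OF adm] deriv_f_ord[OF adm])
          (simp add: chi'_def \<eta>_ord)
      then show ?thesis by (rule ord_ge_mono) simp
    qed
    have "mfps_compose (mfps_deriv j f') chi' - mfps_compose (mfps_deriv j f) chi
      - (mfps_const (2 * quad_coeff j) * \<eta> j + E j)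
      = (mfps_compose (mfps_deriv j \<phi>) chi' - E j) + (mfps_compose ?r chi' - mfps_compose ?r chi)"
      by (simp add: f'_def mfps_deriv_add mfps_compose_add mfps_compose_diff mfps_compose_const_mult
          mfps_compose_X chi_ord[OF adm'] chi_ord[OF adm]) (simp add: chi'_def algebra_simps)
    then show ?thesis using ord_ge_add[OF 1 2] by (simp only:)
  qed
  have W': "euler_lagrange lam f' chi' j \<in> ord_ge (2 * k + 5)" for j
  proof -
    have "euler_lagrange lam f' chi' j \<in> ord_ge (2 * (k + 2))"
    proof (rule ord_geI)
      fix m :: "nat ^ ('n + 'n)" assume "mdeg m < 2 * (k + 2)"
      then have m: "mdeg m \<le> d" by (simp add: d_def)
      have "mfps_nth (euler_lagrange lam f' chi' j) m = mfps_nth (?W j) m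
          - ((2 - multiplier lam m - inverse (multiplier lam m)) * mfps_nth (\<eta> j) m
         + 4 * f0 * (2 * quad_coeff j * mfps_nth (\<eta> j) m + mfps_nth (E j) m)) / (2 * f0)"
        using euler_lagrange_linearize(1)[of f f' d chi chi' m j] f_ord[OF adm] \<phi>_ord m d3 chi_ord[OF adm] chi_ord[OF adm'] \<eta>_ord
          ord_ge_diffD[OF \<Delta>[of j], of m]
        by (simp add: f'_def chi'_def)
      also have "\<dots> = mfps_nth (?W j) m - (eigval j m * mfps_nth (\<eta> j) m + 4 * f0 * mfps_nth (E j) m) / (2 * f0)"
        by (simp add: eigval_quad_coeff[of m j, symmetric] algebra_simps)
      also have "\<dots> = 0" unfolding solve[OF m, symmetric] using f0_neg by simp
      finally show "mfps_nth (euler_lagrange lam f' chi' j) m = 0" .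
    qed
    then have "euler_lagrange lam f' chi' j \<in> ord_ge (2 * (k + 2) + 1)"
      by (rule ord_ge_odd) (rule euler_lagrange_odd[OF adm'])
    moreover have "2 * (k + 2) + 1 = 2 * k + 5" by simp
    ultimately show ?thesis by (simp only:)
  qed
  have "f' - f \<in> ord_ge (2 * k + 4)" "chi' j - chi j \<in> ord_ge (2 * k + 3)" for j
    using \<eta>_ord ord_ge_mono[OF \<phi>_ord, of "2 * k + 4"] by (simp_all add: f'_def chi'_def d_def)
  with adm' W' show ?thesis by blast
qed

text \<open>The coefficient of degree \<open>k\<close> no longer changes after the \<open>k\<close>-th step, so the limit takes it
  from there. The limit agrees with the \<open>k\<close>-th pair up to an order growing with \<open>k\<close>, so its
  Euler-Lagrange series are of arbitrarily high order.\<close>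
lemma exists_solution: "\<exists>f chi. admissible f chi \<and> (\<forall>j. euler_lagrange lam f chi j = 0)"
proof -
  define P where "P k p \<longleftrightarrow> admissible (fst p) (snd p) \<and> (\<forall>j. euler_lagrange lam (fst p) (snd p) j \<in> ord_ge (2 * k + 3))"
    for k and p :: "(complex, 'n) mfps \<times> ('n \<Rightarrow> 'n zseries)"
  define Q where "Q k p q \<longleftrightarrow> fst q - fst p \<in> ord_ge (2 * k + 4) \<and> (\<forall>j. snd q j - snd p j \<in> ord_ge (2 * k + 3))"
    for k and p q :: "(complex, 'n) mfps \<times> ('n \<Rightarrow> 'n zseries)"
  have "\<exists>S. \<forall>k. P k (S k) \<and> Q k (S k) (S (Suc k))"
  proof (rule dependent_nat_choice)
    show "\<exists>p. P 0 p"
      using admissible_base euler_lagrange_base by (intro exI[of _ "(fbase, chi1)"]) (simp add: P_def)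
  next
    fix p k assume "P k p"
    then obtain f' chi' where "admissible f' chi'" "\<forall>j. euler_lagrange lam f' chi' j \<in> ord_ge (2 * k + 5)"
      "f' - fst p \<in> ord_ge (2 * k + 4)" "\<forall>j. chi' j - snd p j \<in> ord_ge (2 * k + 3)"
      unfolding P_def using raise_order[of "fst p" "snd p" k] by blast
    moreover have "2 * Suc k + 3 = 2 * k + 5" by simp
    ultimately show "\<exists>q. P (Suc k) q \<and> Q k p q"
      unfolding P_def Q_def by (intro exI[of _ "(f', chi')"]) (simp only: fst_conv snd_conv simp_thms)
  qed
  then obtain S where P: "P k (S k)" and Q: "Q k (S k) (S (Suc k))" for k by blast
  define fs where "fs k = fst (S k)" for k
  define cs where "cs k = snd (S k)" for k
  have adm: "admissible (fs k) (cs k)" and W: "euler_lagrange lam (fs k) (cs k) j \<in> ord_ge (2 * k + 3)" for k j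
    using P[of k] by (auto simp: P_def fs_def cs_def)
  have step: "fs n - fs k \<in> ord_ge (2 * k + 4) \<and> (\<forall>j. cs n j - cs k j \<in> ord_ge (2 * k + 3))" if "k \<le> n" for k n
    using that
  proof (induction n rule: dec_induct)
    case (step n)
    have "fs (Suc n) - fs n \<in> ord_ge (2 * n + 4)" "cs (Suc n) j - cs n j \<in> ord_ge (2 * n + 3)" for j
      using Q[of n] by (simp_all add: Q_def fs_def cs_def)
    then have "fs (Suc n) - fs n \<in> ord_ge (2 * k + 4)" "cs (Suc n) j - cs n j \<in> ord_ge (2 * k + 3)" for j
      using step(1) by (auto intro: ord_ge_mono[of _ "2 * n + 4" "2 * k + 4"] ord_ge_mono[of _ "2 * n + 3" "2 * k + 3"])
    then show ?case using step(3) by (blast intro: ord_ge_trans)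
  qed simp
  define f where "f = Abs_mfps (\<lambda>m. mfps_nth (fs (mdeg m)) m)"
  define chi where "chi j = Abs_mfps (\<lambda>m. mfps_nth (cs (mdeg m) j) m)" for j
  have f: "f - fs k \<in> ord_ge (2 * k + 4)" for k
  proof (rule ord_geI)
    fix m :: "nat ^ 'n" assume m: "mdeg m < 2 * k + 4"
    have "mfps_nth (fs (mdeg m)) m = mfps_nth (fs k) m"
    proof (cases "k \<le> mdeg m")
      case True
      then show ?thesis using step[OF True] m ord_ge_diffD by blast
    next
      case False
      then have "fs k - fs (mdeg m) \<in> ord_ge (2 * mdeg m + 4)" using step[of "mdeg m" k] by simp
      from ord_ge_diffD[OF this, of m] show ?thesis by simp
    qed
    then show "mfps_nth (f - fs k) m = 0" by (simp add: f_def)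
  qed
  have chi: "chi j - cs k j \<in> ord_ge (2 * k + 3)" for k j
  proof (rule ord_geI)
    fix m :: "nat ^ ('n + 'n)" assume m: "mdeg m < 2 * k + 3"
    have "mfps_nth (cs (mdeg m) j) m = mfps_nth (cs k j) m"
    proof (cases "k \<le> mdeg m")
      case True
      then show ?thesis using step[OF True] m ord_ge_diffD by blast
    next
      case False
      then have "cs k j - cs (mdeg m) j \<in> ord_ge (2 * mdeg m + 3)" using step[of "mdeg m" k] by simp
      from ord_ge_diffD[OF this, of m] show ?thesis by simp
    qed
    then show "mfps_nth (chi j - cs k j) m = 0" by (simp add: chi_def)
  qed
  have adm_lim: "admissible f chi"
    unfolding admissible_def
  proof (intro conjI allI impI)
    fix m assume "mfps_nth f m \<noteq> 0"
    then show "\<exists>s. m = s + s" using f_even[OF adm] by (simp add: f_def)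
  next
    fix m show "mfps_nth f m \<in> \<real>" by (simp add: f_def f_real[OF adm])
  next
    show "f - fbase \<in> ord_ge 3"
      by (rule ord_ge_trans[OF ord_ge_mono[OF f[of 0]] f_base[OF adm]]) simp
  next
    fix j m assume "mfps_nth (chi j) m \<noteq> 0"
    then show "odd (mdeg m)" using chi_odd[OF adm] by (simp add: chi_def)
  next
    fix j show "zconj (chi j) = chi j"
    proof (rule mfps_eqI)
      fix m show "mfps_nth (zconj (chi j)) m = mfps_nth (chi j) m"
        using arg_cong[OF chi_real[OF adm[of "mdeg m"], of j], of "\<lambda>g. mfps_nth g m"]
        by (simp add: chi_def mfps_nth_zconj)
    qed
  next
    fix j show "chi j - chi1 j \<in> ord_ge 2"
      by (rule ord_ge_trans[OF ord_ge_mono[OF chi[of j 0]] chi_base[OF adm]]) simp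
  qed
  have "euler_lagrange lam f chi j - 0 \<in> ord_ge k" for j k
  proof -
    have "f - fs k \<in> ord_ge (2 * k + 3 + 1)" using f[of k] by (rule ord_ge_mono) simp
    then have "euler_lagrange lam f chi j - euler_lagrange lam (fs k) (cs k) j \<in> ord_ge (2 * k + 3)"
      by (intro euler_lagrange_linearize(2) f_ord[OF adm] chi_ord[OF adm] chi_ord[OF adm_lim] chi) simp_all
    from ord_ge_add[OF this W[of k j]] have "euler_lagrange lam f chi j \<in> ord_ge (2 * k + 3)" by simp
    then show ?thesis by (simp add: ord_ge_mono[where d' = k])
  qed
  then have "euler_lagrange lam f chi j = 0" for j by (rule eq_if_diff_ord_ge)
  with adm_lim show ?thesis by blast
qed

section \<open>Consequences for a solution\<close>

text \<open>Only the linear terms of \<open>\<chi>\<close> matter. The determinant splits into blocks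
  with rows proportional to \<open>(\<lambda>\<^sub>j\<^sup>-\<^sup>1, \<lambda>\<^sub>j)\<close> and \<open>(1, 1)\<close>, which are independent as \<open>\<lambda>\<^sub>j\<^sup>2 \<noteq> 1\<close> by nonresonance.\<close>
lemma det_jacobian:
  assumes adm: "admissible f chi"
  shows "det (jacobian_at_0 (case_sum (\<lambda>j. rot (inv_rot lam) (chi j)) chi)) \<noteq> 0"
proof -
  let ?J = "jacobian_at_0 (case_sum (\<lambda>j. rot (inv_rot lam) (chi j)) chi)"
  have "x = 0" if x: "?J *v x = 0" for x :: "complex ^ ('n + 'n)"
  proof -
    have UNIV_sum_sum: "(\<Sum>v\<in>UNIV. g v) = (\<Sum>j\<in>UNIV. g (Inl j)) + (\<Sum>j\<in>UNIV. g (Inr j))"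
      for g :: "'n + 'n \<Rightarrow> complex"
      by (simp add: UNIV_Plus_UNIV[symmetric] sum.Plus del: UNIV_Plus_UNIV)
    have "x $ Inl j = 0 \<and> x $ Inr j = 0" for j
    proof -
      have "(?J *v x) $ Inr j = a $ j * (x $ Inl j + x $ Inr j)"
        by (simp add: matrix_vector_mult_def jacobian_at_0_def deriv_chi_0[OF adm] UNIV_sum_sum
            if_distrib if_distribR distrib_left cong: if_cong)
      then have 1: "x $ Inr j = - (x $ Inl j)"
        using x a_pos[of j] by (simp add: eq_neg_iff_add_eq_0 add.commute)
      have "(?J *v x) $ Inl j = a $ j * (inverse (lam $ j) * x $ Inl j + lam $ j * x $ Inr j)"
        by (simp add: matrix_vector_mult_def jacobian_at_0_def mfps_deriv_rot mfps_nth_rot multiplier_def inv_rot_def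
            mfps_nth_const deriv_chi_0[OF adm] UNIV_sum_sum if_distrib if_distribR distrib_left cong: if_cong)
      then have "(inverse (lam $ j) - lam $ j) * x $ Inl j = 0"
        using x a_pos[of j] 1 by (auto simp: algebra_simps)
      moreover have "inverse (lam $ j) \<noteq> lam $ j"
      proof
        assume "inverse (lam $ j) = lam $ j"
        then have "lam $ j * lam $ j = 1" using lam_nz[of j] by (metis right_inverse)
        moreover have "multiplier lam 0 = 1" by (simp add: multiplier_def)
        then have "multiplier lam (axis (Inl j) 1) = lam $ j"
          using multiplier_add_axis[of 0 "Inl j"] by simp
        ultimately have "multiplier lam (axis (Inl j) 1 + axis (Inl j) 1) = 1"
          by (simp add: multiplier_add_axis)
        then have "balanced (axis (Inl j) 1 + axis (Inl j) 1)" by (rule multiplier_eq_1)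
        then show False by (auto simp: balanced_iff axis_def dest: spec[of _ j])
      qed
      ultimately show ?thesis using 1 by simp
    qed
    then show "x = 0" by (simp add: vec_sum_eq_iff vec_eq_iff split_sum_all)
  qed
  then have "\<exists>B. B ** ?J = mat 1" by (simp add: matrix_left_invertible_ker)
  then have "invertible ?J" by (metis invertible_left_inverse)
  then show ?thesis by (simp add: invertible_det_nz)
qed

text \<open>If the form vanishes then so does \<open>d\<langle>G\<rangle>\<close>, and only the constant term of \<open>\<langle>G\<rangle>\<close> is left.\<close>
lemma avg_lagrangian:
  assumes adm: "admissible f chi" and W: "\<And>j. euler_lagrange lam f chi j = 0"
  shows "avg (lagrangian f (\<lambda>i. rot (inv_rot lam) (chi i)) chi) = lagrangian f (\<lambda>_. 0) (\<lambda>_. 0)"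
proof (rule mfps_eqI)
  fix m :: "nat ^ ('n + 'n)"
  let ?G = "lagrangian f (\<lambda>i. rot (inv_rot lam) (chi i)) chi" and ?l = "csqrt (4 * (mfps_nth f 0)\<^sup>2)"
  have c0: "mfps_compose f (\<lambda>_. 0) = (mfps_const (mfps_nth f 0) :: 'n zseries)" for f :: "(complex, 'n) mfps"
  proof -
    have "mfps_scale (\<lambda>_. 0) f = mfps_const (mfps_nth f 0)"
    proof (rule mfps_eqI)
      fix m show "mfps_nth (mfps_scale (\<lambda>_. 0) f) m = mfps_nth (mfps_const (mfps_nth f 0)) m"
      proof (cases "m = 0")
        case False
        then obtain i where "m $ i > 0" by (auto simp: vec_eq_iff)
        with False show ?thesis by (auto simp: mfps_nth_scale mfps_nth_const)
      qed (simp add: mfps_nth_scale mfps_nth_const)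
    qed
    then show ?thesis using mfps_compose_scaled[of f "\<lambda>_. 0" "\<lambda>_. 0 :: 'n zseries"] by simp
  qed
  have sq: "lagrangian_sq f (\<lambda>_. 0) (\<lambda>_. 0) = mfps_const (4 * (mfps_nth f 0)\<^sup>2)"
    by (simp add: lagrangian_sq_def c0 power2_eq_square mfps_const_mult mfps_const_numeral)
  have L: "lagrangian f (\<lambda>_. 0) (\<lambda>_. 0) = mfps_const ?l"
    unfolding lagrangian_eq sq using f_0_nz[OF adm]
    by (intro mfps_sqrt_unique) (simp_all add: mfps_nth_const power2_csqrt flip: mfps_const_power)
  show "mfps_nth (avg ?G) m = mfps_nth (lagrangian f (\<lambda>_. 0) (\<lambda>_. 0)) m"
  proof (cases "m = 0 \<or> \<not> balanced m")
    case True
    have "balanced (0 :: nat ^ ('n + 'n))" by (simp add: balanced_iff)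
    with True show ?thesis
      by (auto simp: mfps_nth_avg L mfps_nth_const nth_lagrangian_0 rot_ord_ge chi_ord[OF adm] f_0_nz[OF adm])
  next
    case False
    then obtain v where "m $ v > 0" by (auto simp: vec_eq_iff)
    then obtain m' where m: "m = m' + axis v 1" using eq_add_axis_if_pos by blast
    have "of_nat (m' $ v + 1) * mfps_nth ?G m = mfps_nth (billiard_form lam f chi v) m'"
      unfolding m using False m
      by (intro billiard_form_balanced[symmetric]) (simp_all add: lam_nz chi_ord[OF adm] f_0_nz[OF adm])
    also have "\<dots> = 0" by (simp add: billiard_form_eq chi_ord[OF adm] W)
    finally have "mfps_nth ?G m = 0" by (simp del: of_nat_add of_nat_Suc)
    with False show ?thesis by (simp add: mfps_nth_avg L mfps_nth_const)
  qed
qed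

end

section \<open>Existence of the formal billiard\<close>

theorem theorem1:
  fixes lam :: "complex ^ 'n" and f0 :: real and a :: "real ^ 'n"
  assumes "\<And>j. norm (lam $ j) = 1"
    and "nonresonant lam"
    and "f0 < 0"
    and "\<And>j. a $ j > 0"
  shows "\<exists>(f :: (complex, 'n) mfps) (chi :: 'n \<Rightarrow> 'n zseries).
    (\<forall>m. mfps_nth f m \<noteq> 0 \<longrightarrow> (\<exists>s. m = s + s)) \<and>
    (\<forall>j d. even d \<longrightarrow> mfps_hom_part d (chi j) = 0) \<and>
    mfps_hom_part 0 f = mfps_const (complex_of_real f0) \<and>
    mfps_hom_part 2 f =
      (\<Sum>j\<in>UNIV. mfps_const ((2 - lam $ j - inverse (lam $ j)) / (- 8 * complex_of_real f0)) * mfps_X j ^ 2) \<and>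
    (\<forall>j. mfps_hom_part 1 (chi j) =
      mfps_const (complex_of_real (a $ j)) * (mfps_X (Inl j) + mfps_X (Inr j))) \<and>
    form_bracket (billiard_form lam f chi) = (\<lambda>_. 0) \<and>
    avg (mfps_sqrt ((\<Sum>j\<in>UNIV. (tau_diff (inv_rot lam) (chi j)) ^ 2)
                    + (tau_sum (inv_rot lam) (mfps_compose f chi)) ^ 2))
      = lagrangian f (\<lambda>_. 0) (\<lambda>_. 0) \<and>
    (\<forall>m. mfps_nth f m \<in> \<real>) \<and>
    (\<forall>j. mfps_scale (\<lambda>i. if i = j then -1 else 1) f = f) \<and>
    (\<forall>j k k'. mfps_nth (chi j) (zexp k k') = cnj (mfps_nth (chi j) (zexp k' k))) \<and>
    (\<forall>j. mfps_scale (\<lambda>_. -1) (chi j) = - chi j) \<and>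
    det (jacobian_at_0 (case_sum (\<lambda>j. rot (inv_rot lam) (chi j)) chi)) \<noteq> 0"
proof -
  interpret billiard_data lam f0 a using assms by unfold_locales
  obtain f chi where adm: "admissible f chi" and W: "\<And>j. euler_lagrange lam f chi j = 0"
    using exists_solution by blast
  have chi_hom_even: "mfps_hom_part d (chi j) = 0" if "even d" for j d
    by (rule mfps_eqI) (use that chi_odd[OF adm, of j] in \<open>auto simp: mfps_hom_part_def\<close>)
  have f_hom_0: "mfps_hom_part 0 f = mfps_const (complex_of_real f0)"
    by (rule mfps_eqI) (simp add: mfps_hom_part_def mfps_nth_const f_0[OF adm])
  have f_hom_2: "mfps_hom_part 2 f = (\<Sum>j\<in>UNIV. mfps_const (quad_coeff j) * mfps_X j ^ 2)"
  proof (rule mfps_eqI)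
    fix m :: "nat ^ 'n"
    show "mfps_nth (mfps_hom_part 2 f) m = mfps_nth (\<Sum>j\<in>UNIV. mfps_const (quad_coeff j) * mfps_X j ^ 2) m"
    proof (cases "mdeg m = 2")
      case True
      then have "m \<noteq> 0" by auto
      then show ?thesis
        using ord_ge_diffD[OF f_base[OF adm], of m] True by (simp add: mfps_hom_part_def fbase_def mfps_nth_const)
    next
      case False
      then show ?thesis by (auto simp: mfps_hom_part_def mfps_nth_X_power intro!: sum.neutral)
    qed
  qed
  have chi_hom_1: "mfps_hom_part 1 (chi j) = chi1 j" for j
  proof (rule mfps_eqI)
    fix m
    show "mfps_nth (mfps_hom_part 1 (chi j)) m = mfps_nth (chi1 j) m"
      using ord_ge_diffD[OF chi_base[OF adm, of j], of m] by (auto simp: mfps_hom_part_def nth_chi1)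
  qed
  have form: "form_bracket (billiard_form lam f chi) = (\<lambda>_. 0)"
  proof
    fix v
    have "billiard_form lam f chi v = 0" for v by (simp add: billiard_form_eq chi_ord[OF adm] W)
    then show "form_bracket (billiard_form lam f chi) v = 0"
      by (intro mfps_eqI) (simp add: form_bracket_def mfps_nth_form_avg)
  qed
  have action: "mfps_sqrt ((\<Sum>j\<in>UNIV. (tau_diff (inv_rot lam) (chi j)) ^ 2)
      + (tau_sum (inv_rot lam) (mfps_compose f chi)) ^ 2) = lagrangian f (\<lambda>i. rot (inv_rot lam) (chi i)) chi"
    by (subst lagrangian_commute)
      (simp only: lagrangian_def tau_diff_def tau_sum_def rot_compose[OF chi_ord[OF adm]])
  have chi_cnj: "mfps_nth (chi j) (zexp k k') = cnj (mfps_nth (chi j) (zexp k' k))" for j k k'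
    using arg_cong[OF chi_real[OF adm, of j], of "\<lambda>g. mfps_nth g (zexp k k')"] by (simp add: mfps_nth_zconj)
  have scale1: "mfps_scale (\<lambda>i. if i = j then -1 else 1) f = f" for j
    by (rule scale_f[OF adm]) simp
  show ?thesis
    by (intro exI[of _ f] exI[of _ chi] conjI allI impI)
      (fact f_even[OF adm] chi_hom_even f_hom_0 f_hom_2[unfolded quad_coeff_def] chi_hom_1[unfolded chi1_def]
        form avg_lagrangian[OF adm W, folded action] f_real[OF adm] scale1 chi_cnj scale_chi[OF adm]
        det_jacobian[OF adm])+
qed

end
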